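(* Let $K,R,G,\sigma_i,\xi_i,n_i,t_{ij}$ be as fixed in the context, and let $n=\prod_{i=1}^\ell n_i$. For each character $\mathcal{X}$ of $G$, consider the following conditions. (1) $R^{\mathcal{X}}$ is locally free on ${}^*\mathrm{Spec}\,R^G\setminus\{\mathfrak{m}_G\}$. (2) $(X_1^n,\dots,X_d^n)\subseteq \operatorname{tr}_{R^G}(R^{\mathcal{X}})$, where $(X_1^n,\dots,X_d^n)$ is the ideal of $R^G$ generated by these elements. (3) For all $1\le j\le d$, there exists an integer $0<u_j\le n$ such that $X_j^{u_j}\in R^{\mathcal{X}}$. Then (3) $\Rightarrow$ (2) $\Rightarrow$ (1) holds. Moreover, (1) $\Rightarrow$ (3) also holds if $n_1,\dots,n_\ell$ are pairwise coprime and $G$ has no pseudo-reflection.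
   Context: Let $K$ be an algebraically closed field, $R=K[X_1,\dots,X_d]$ with $d\ge2$ and $\deg X_j=1$, and $G=\langle\sigma_1,\dots,\sigma_\ell\rangle\subseteq \mathrm{GL}(K^d)$ a finite abelian group whose order is not divisible by the characteristic of $K$. A basis of $K^d$ is chosen so that each $\sigma_i$ is the diagonal matrix with diagonal entries $\xi_i^{t_{i1}},\dots,\xi_i^{t_{id}}$, with $t_{ij}$ non-negative integers and $\xi_i\in K$ a primitive $n_i$-th root of $1$, and $\gcd(t_{i1},\dots,t_{id},n_i)=1$ for all $i$. $G$ acts on $R$ by $K$-algebra automorphisms with $\sigma_i(X_j)=\xi_i^{t_{ij}}X_j$. The ring of invariants is $R^G=\{a\in R\mid \sigma(a)=a\ \forall\sigma\in G\}$, a graded subring of $R$ with graded maximal ideal $\mathfrak{m}_G$. A character is a group homomorphism $\mathcal{X}:G\to\mathrm{GL}(K)=K^\times$, and $R^{\mathcal{X}}=\{a\in R\mid\sigma(a)=\mathcal{X}(\sigma)a\ \forall\sigma\in G\}$, an $R^G$-module. ${}^*\mathrm{Spec}\,R^G$ denotes the set of graded prime ideals of $R^G$; $R^{\mathcal{X}}$ is locally free on $V\subseteq\mathrm{Spec}\,R^G$ if $(R^{\mathcal{X}})_{\mathfrak{p}}$ is a free $(R^G)_{\mathfrak{p}}$-module for all $\mathfrak{p}\in V$. The trace of a finitely generated module $M$ over a commutative Noetherian ring $A$ is $\operatorname{tr}_A(M)=\sum_{f\in\operatorname{Hom}_A(M,A)}f(M)$. An element $\sigma\in\mathrm{GL}(K^d)$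 is a pseudo-reflection if it has finite order and its eigenspace for the eigenvalue $1$ has dimension $d-1$; $G$ has no pseudo-reflection if no element of $G$ is one. *)

theory Defs
  imports
    "HOL-Analysis.Analysis"
    "HOL-Library.Poly_Mapping"
    "HOL-Algebra.Algebraic_Closure_Type"
    "HOL-Algebra.Module"
begin

section \<open>Commutative algebra over \<open>HOL-Algebra\<close> rings and modules\<close>

text \<open>
  Records of type \<open>('a, 'b) module\<close> extend ring records; for a module the fields
  \<open>mult\<close> and \<open>one\<close> carry no information.
\<close>

definition self_module :: "'a ring \<Rightarrow> ('a, 'a) module" where
  "self_module A =
     \<lparr>carrier = carrier A, mult = mult A, one = \<one>\<^bsub>A\<^esub>, zero = \<zero>\<^bsub>A\<^esub>, add = add A,
      smult = mult A\<rparr>"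

definition mod_homs :: "'a ring \<Rightarrow> ('a, 'b) module \<Rightarrow> ('a, 'c) module \<Rightarrow> ('b \<Rightarrow> 'c) set" where
  "mod_homs A M N =
     {f \<in> carrier M \<rightarrow> carrier N.
        (\<forall>x\<in>carrier M. \<forall>y\<in>carrier M. f (x \<oplus>\<^bsub>M\<^esub> y) = f x \<oplus>\<^bsub>N\<^esub> f y) \<and>
        (\<forall>a\<in>carrier A. \<forall>x\<in>carrier M. f (a \<odot>\<^bsub>M\<^esub> x) = a \<odot>\<^bsub>N\<^esub> f x)}"

text \<open>The sum of the family of ideals \<open>f ` carrier M\<close>: all finite sums of elements of its members.\<close>

definition module_trace :: "'a ring \<Rightarrow> ('a, 'b) module \<Rightarrow> 'a set" where
  "module_trace A M =
     {\<Oplus>\<^bsub>A\<^esub>f\<in>F. f (x f) | F x.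
        finite F \<and> F \<subseteq> mod_homs A M (self_module A) \<and> x \<in> F \<rightarrow> carrier M}"

definition module_basis :: "'a ring \<Rightarrow> ('a, 'b) module \<Rightarrow> 'b set \<Rightarrow> bool" where
  "module_basis A M B \<longleftrightarrow>
     B \<subseteq> carrier M \<and>
     (\<forall>x\<in>carrier M. \<exists>F c. finite F \<and> F \<subseteq> B \<and> c \<in> F \<rightarrow> carrier A \<and>
        x = (\<Oplus>\<^bsub>M\<^esub>b\<in>F. c b \<odot>\<^bsub>M\<^esub> b)) \<and>
     (\<forall>F c. finite F \<and> F \<subseteq> B \<and> c \<in> F \<rightarrow> carrier A \<and>
        (\<Oplus>\<^bsub>M\<^esub>b\<in>F. c b \<odot>\<^bsub>M\<^esub> b) = \<zero>\<^bsub>M\<^esub> \<longrightarrow> (\<forall>b\<in>F. c b = \<zero>\<^bsub>A\<^esub>))"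

definition free_module :: "'a ring \<Rightarrow> ('a, 'b) module \<Rightarrow> bool" where
  "free_module A M \<longleftrightarrow> (\<exists>B. module_basis A M B)"

text \<open>
  Localization at a multiplicative set \<open>S\<close>. The fraction \<open>m / s\<close> is the class of \<open>(m, s)\<close>;
  operations on classes are unions over representatives, as in \<^theory>\<open>HOL.Equiv_Relations\<close>.
\<close>

definition frac_rel :: "'a ring \<Rightarrow> ('a, 'b) module \<Rightarrow> 'a set \<Rightarrow> (('b \<times> 'a) \<times> ('b \<times> 'a)) set" where
  "frac_rel A M S =
     {((m, s), (m', s')). m \<in> carrier M \<and> m' \<in> carrier M \<and> s \<in> S \<and> s' \<in> S \<and>
        (\<exists>u\<in>S. u \<odot>\<^bsub>M\<^esub> (s' \<odot>\<^bsub>M\<^esub> m) = u \<odot>\<^bsub>M\<^esub> (s \<odot>\<^bsub>M\<^esub> m'))}"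

definition fraction :: "'a ring \<Rightarrow> ('a, 'b) module \<Rightarrow> 'a set \<Rightarrow> 'b \<Rightarrow> 'a \<Rightarrow> ('b \<times> 'a) set" where
  "fraction A M S m s = frac_rel A M S `` {(m, s)}"

definition loc_module ::
    "'a ring \<Rightarrow> ('a, 'b) module \<Rightarrow> 'a set \<Rightarrow> (('a \<times> 'a) set, ('b \<times> 'a) set) module" where
  "loc_module A M S =
     \<lparr>carrier = (carrier M \<times> S) // frac_rel A M S,
      mult = (\<lambda>_ _. undefined), one = undefined,
      zero = fraction A M S \<zero>\<^bsub>M\<^esub> \<one>\<^bsub>A\<^esub>,
      add = (\<lambda>x y. \<Union>(m, s)\<in>x. \<Union>(m', s')\<in>y.
               fraction A M S ((s' \<odot>\<^bsub>M\<^esub> m) \<oplus>\<^bsub>M\<^esub> (s \<odot>\<^bsub>M\<^esub> m')) (s \<otimes>\<^bsub>A\<^esub> s')),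
      smult = (\<lambda>x y. \<Union>(a, s)\<in>x. \<Union>(m, s')\<in>y. fraction A M S (a \<odot>\<^bsub>M\<^esub> m) (s \<otimes>\<^bsub>A\<^esub> s'))\<rparr>"

definition loc_ring :: "'a ring \<Rightarrow> 'a set \<Rightarrow> ('a \<times> 'a) set ring" where
  "loc_ring A S =
     \<lparr>carrier = carrier (loc_module A (self_module A) S),
      mult = smult (loc_module A (self_module A) S),
      one = fraction A (self_module A) S \<one>\<^bsub>A\<^esub> \<one>\<^bsub>A\<^esub>,
      zero = zero (loc_module A (self_module A) S),
      add = add (loc_module A (self_module A) S)\<rparr>"

definition locally_free_on :: "'a ring \<Rightarrow> ('a, 'b) module \<Rightarrow> 'a set set \<Rightarrow> bool" where
  "locally_free_on A M V \<longleftrightarrow>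
     (\<forall>p\<in>V. free_module (loc_ring A (carrier A - p)) (loc_module A M (carrier A - p)))"

section \<open>The polynomial ring and its grading\<close>

text \<open>
  \<open>('k, 'n) mpol\<close> is the polynomial ring over \<open>'k\<close> in the variables \<open>Var j\<close>, \<open>j :: 'n\<close>, with the
  convolution product of \<^theory>\<open>HOL-Library.Poly_Mapping\<close>.
\<close>

type_synonym ('k, 'n) mpol = "('n \<Rightarrow>\<^sub>0 nat) \<Rightarrow>\<^sub>0 'k"

definition Const :: "'k::comm_ring_1 \<Rightarrow> ('k, 'n) mpol" where
  "Const c = Poly_Mapping.single 0 c"

definition Var :: "'n \<Rightarrow> ('k::comm_ring_1, 'n) mpol" where
  "Var j = Poly_Mapping.single (Poly_Mapping.single j 1) 1"

definition mon_degree :: "('n::finite \<Rightarrow>\<^sub>0 nat) \<Rightarrow> nat" where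
  "mon_degree m = (\<Sum>j\<in>UNIV. Poly_Mapping.lookup m j)"

definition hom_component :: "nat \<Rightarrow> ('k::comm_ring_1, 'n::finite) mpol \<Rightarrow> ('k, 'n) mpol" where
  "hom_component k f =
     (\<Sum>m | m \<in> Poly_Mapping.keys f \<and> mon_degree m = k.
        Poly_Mapping.single m (Poly_Mapping.lookup f m))"

text \<open>For a graded subring \<open>A\<close> of the polynomial ring: its graded primes, and its ideal
  of elements without component of degree \<open>0\<close>.\<close>

definition graded_Spec :: "('k::comm_ring_1, 'n::finite) mpol ring \<Rightarrow> ('k, 'n) mpol set set" where
  "graded_Spec A = {p. primeideal p A \<and> (\<forall>f\<in>p. \<forall>k. hom_component k f \<in> p)}"

definition graded_max_ideal :: "('k::comm_ring_1, 'n::finite) mpol ring \<Rightarrow> ('k, 'n) mpol set" where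
  "graded_max_ideal A = {f \<in> carrier A. hom_component 0 f = 0}"

section \<open>Linear groups, invariants and semi-invariants\<close>

definition GL :: "('k::field^'n^'n) monoid" where
  "GL = \<lparr>carrier = {A. invertible A}, mult = (**), one = mat 1\<rparr>"

definition diag_matrix :: "('n \<Rightarrow> 'k::zero) \<Rightarrow> 'k^'n^'n" where
  "diag_matrix a = (\<chi> i j. if i = j then a j else 0)"

definition primitive_root_of_unity :: "nat \<Rightarrow> 'k::field \<Rightarrow> bool" where
  "primitive_root_of_unity n z \<longleftrightarrow> n > 0 \<and> z ^ n = 1 \<and> (\<forall>k. 0 < k \<and> k < n \<longrightarrow> z ^ k \<noteq> 1)"

definition pseudo_reflection :: "'k::field^'n^'n \<Rightarrow> bool" where
  "pseudo_reflection A \<longleftrightarrow>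
     A \<in> carrier GL \<and> (\<exists>k::nat. k > 0 \<and> A [^]\<^bsub>GL\<^esub> k = \<one>\<^bsub>GL\<^esub>) \<and>
     vec.dim {v. A *v v = v} = CARD('n) - 1"

text \<open>
  The \<open>'k\<close>-algebra endomorphism induced by \<open>A\<close>, with \<open>Var j\<close> playing the role of the \<open>j\<close>-th basis
  vector: \<open>Var j\<close> is sent to \<open>\<Sum>i. A $ i $ j * Var i\<close>. This is a left action, and
  \<open>diag_matrix a\<close> sends \<open>Var j\<close> to \<open>a j * Var j\<close>.
\<close>

definition poly_act :: "'k::field^'n^'n \<Rightarrow> ('k, 'n) mpol \<Rightarrow> ('k, 'n) mpol" where
  "poly_act A f =
     (\<Sum>m\<in>Poly_Mapping.keys f. Const (Poly_Mapping.lookup f m) *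
        (\<Prod>j\<in>UNIV. (\<Sum>i\<in>UNIV. Const (A $ i $ j) * Var i) ^ Poly_Mapping.lookup m j))"

definition invariant_ring :: "('k::field^'n^'n) set \<Rightarrow> ('k, 'n) mpol ring" where
  "invariant_ring G =
     \<lparr>carrier = {f. \<forall>A\<in>G. poly_act A f = f}, mult = (*), one = 1, zero = 0, add = (+)\<rparr>"

text \<open>Characters into the group of units of the field \<open>'k\<close>.\<close>

definition characters :: "('k::field^'n^'n) set \<Rightarrow> ('k^'n^'n \<Rightarrow> 'k) set" where
  "characters G = hom (GL\<lparr>carrier := G\<rparr>) (units_of ring_of_type_algebra)"

definition semi_invariants ::
    "('k::field^'n^'n) set \<Rightarrow> ('k^'n^'n \<Rightarrow> 'k) \<Rightarrow> (('k, 'n) mpol, ('k, 'n) mpol) module" where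
  "semi_invariants G \<phi> =
     \<lparr>carrier = {f. \<forall>A\<in>G. poly_act A f = Const (\<phi> A) * f},
      mult = (\<lambda>_ _. undefined), one = undefined, zero = 0, add = (+), smult = (*)\<rparr>"

end

theory Submission
  imports Defs
begin

text \<open>
  Every element of \<open>G\<close> is diagonal and its entries are \<open>N\<close>-th roots of unity, so \<open>G\<close> multiplies
  each monomial by a scalar, its weight. Hence \<open>R\<^sup>G\<close> and \<open>R\<^sup>\<phi>\<close> are spanned by monomials: those of
  weight \<open>1\<close>, and those of weight \<open>\<phi>\<close> (lemma \<open>semi_invariants_carrier\<close>). The \<open>N\<close>-th power of every
  monomial is invariant. Each argument below is thereby reduced to a statement about monomials,
  and these can be cancelled from equations between polynomials.

  \<^bold>\<open>(3) implies (2).\<close> If \<open>X_j^u\<close> lies in \<open>R\<^sup>\<phi>\<close>, multiplication by \<open>X_j^(N - u)\<close> is a homomorphism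
  \<open>R\<^sup>\<phi> \<rightarrow> R\<^sup>G\<close> that takes \<open>X_j^u\<close> to \<open>X_j^N\<close> (\<open>trace_contains_powers\<close>).

  \<^bold>\<open>(2) implies (1).\<close> A graded prime that contains all \<open>X_j^N\<close> contains the \<open>N\<close>-th powers of all
  invariant monomials other than \<open>1\<close>, and so is the graded maximal ideal
  (\<open>graded_prime_misses_Var_power\<close>). At any other graded prime \<open>p\<close> the trace is therefore not
  contained in \<open>p\<close>: some homomorphism \<open>f\<close> and some monomial \<open>x\<close> satisfy \<open>f x \<notin> p\<close>. Since \<open>R\<^sup>\<phi>\<close> has
  rank one, \<open>f x * y = f y * x\<close> for all \<open>y\<close>, so \<open>x\<close> generates the localization freely
  (\<open>free_at_prime_if_trace\<close>).

  \<^bold>\<open>(1) implies (3).\<close> Fix \<open>j\<close>, and localize at the prime of the invariants that vanish on the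
  \<open>j\<close>-th coordinate axis. Freeness supplies a linear coordinate function that takes a unit
  value at some monomial \<open>x\<close> of \<open>R\<^sup>\<phi>\<close>, and the rank one relation turns this into a divisibility: up
  to powers of \<open>X_j\<close>, the monomial \<open>x\<close> divides all monomials of \<open>R\<^sup>\<phi>\<close>
  (\<open>ex_least_exponent_off_axis\<close>). If \<open>G\<close> has no pseudo-reflection, then for every \<open>i\<close> the group still
  acts faithfully on the variables other than \<open>X_i\<close>, so \<open>\<phi>\<close> is the weight of a monomial without
  \<open>X_i\<close> (\<open>ex_exponent_avoiding\<close>). Consequently \<open>x\<close> is a power of \<open>X_j\<close>, and its exponent may be
  reduced modulo \<open>N\<close>.
\<close>

section \<open>Localization of modules\<close>

text \<open>
  Viewing a ring as a module over itself lets the localized ring inherit its addition from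
  the localized module; only the laws that involve multiplication remain to be checked.
\<close>
lemma module_self:
  fixes A :: "'a ring"
  assumes "cring A"
  shows "module A (self_module A)"
proof -
  interpret cring A by fact
  have "abelian_group (self_module A)"
    by (rule abelian_groupI) (auto simp: self_module_def a_ac intro: l_neg)
  then show ?thesis
    using assms by (intro moduleI) (auto simp: self_module_def l_distr r_distr m_assoc)
qed

locale localization = module A M for A :: "'a ring" and M :: "('a, 'b) module" +
  fixes S :: "'a set"
  assumes S_subset: "S \<subseteq> carrier A"
    and one_in_S: "\<one>\<^bsub>A\<^esub> \<in> S"
    and S_mult: "\<lbrakk>s \<in> S; t \<in> S\<rbrakk> \<Longrightarrow> s \<otimes>\<^bsub>A\<^esub> t \<in> S"
begin

lemma S_carrier [simp]: "s \<in> S \<Longrightarrow> s \<in> carrier A"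
  using S_subset by blast

lemma smult_left_commute:
  "\<lbrakk>a \<in> carrier A; b \<in> carrier A; x \<in> carrier M\<rbrakk> \<Longrightarrow> a \<odot>\<^bsub>M\<^esub> (b \<odot>\<^bsub>M\<^esub> x) = b \<odot>\<^bsub>M\<^esub> (a \<odot>\<^bsub>M\<^esub> x)"
  by (metis smult_assoc1 R.m_comm)

lemma equiv_frac_rel: "equiv (carrier M \<times> S) (frac_rel A M S)"
proof (rule equivI)
  show "frac_rel A M S \<subseteq> (carrier M \<times> S) \<times> carrier M \<times> S"
    by (auto simp: frac_rel_def)
  show "refl_on (carrier M \<times> S) (frac_rel A M S)"
    using one_in_S by (auto simp: refl_on_def frac_rel_def)
  show "sym (frac_rel A M S)"
    by (auto simp: sym_def frac_rel_def) metis
  show "trans (frac_rel A M S)"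
  proof (rule transI, clarsimp simp: frac_rel_def)
    fix m s m' s' m'' s'' u v
    assume c: "m \<in> carrier M" "m' \<in> carrier M" "m'' \<in> carrier M" "s \<in> S" "s' \<in> S" "s'' \<in> S"
      "u \<in> S" "v \<in> S"
      and e1: "u \<odot>\<^bsub>M\<^esub> (s' \<odot>\<^bsub>M\<^esub> m) = u \<odot>\<^bsub>M\<^esub> (s \<odot>\<^bsub>M\<^esub> m')"
      and e2: "v \<odot>\<^bsub>M\<^esub> (s'' \<odot>\<^bsub>M\<^esub> m') = v \<odot>\<^bsub>M\<^esub> (s' \<odot>\<^bsub>M\<^esub> m'')"
    have "(u \<otimes>\<^bsub>A\<^esub> v \<otimes>\<^bsub>A\<^esub> s') \<odot>\<^bsub>M\<^esub> (s'' \<odot>\<^bsub>M\<^esub> m) = v \<odot>\<^bsub>M\<^esub> (s'' \<odot>\<^bsub>M\<^esub> (u \<odot>\<^bsub>M\<^esub> (s' \<odot>\<^bsub>M\<^esub> m)))"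
      using c by (simp add: smult_assoc1 smult_left_commute)
    also have "\<dots> = s \<odot>\<^bsub>M\<^esub> (u \<odot>\<^bsub>M\<^esub> (v \<odot>\<^bsub>M\<^esub> (s'' \<odot>\<^bsub>M\<^esub> m')))"
      unfolding e1 using c by (simp add: smult_left_commute)
    also have "\<dots> = (u \<otimes>\<^bsub>A\<^esub> v \<otimes>\<^bsub>A\<^esub> s') \<odot>\<^bsub>M\<^esub> (s \<odot>\<^bsub>M\<^esub> m'')"
      unfolding e2 using c by (simp add: smult_assoc1 smult_left_commute)
    finally show "\<exists>u\<in>S. u \<odot>\<^bsub>M\<^esub> (s'' \<odot>\<^bsub>M\<^esub> m) = u \<odot>\<^bsub>M\<^esub> (s \<odot>\<^bsub>M\<^esub> m'')"
      using c S_mult by blast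
  qed
qed

lemma fraction_eq_iff:
  assumes "m \<in> carrier M" "s \<in> S" "m' \<in> carrier M" "s' \<in> S"
  shows "fraction A M S m s = fraction A M S m' s' \<longleftrightarrow>
    (\<exists>u\<in>S. u \<odot>\<^bsub>M\<^esub> (s' \<odot>\<^bsub>M\<^esub> m) = u \<odot>\<^bsub>M\<^esub> (s \<odot>\<^bsub>M\<^esub> m'))"
  using eq_equiv_class_iff[OF equiv_frac_rel, of "(m, s)" "(m', s')"] assms
  by (simp add: fraction_def frac_rel_def)

lemma fraction_eqI:
  assumes "m \<in> carrier M" "s \<in> S" "m' \<in> carrier M" "s' \<in> S"
    "s' \<odot>\<^bsub>M\<^esub> m = s \<odot>\<^bsub>M\<^esub> m'"
  shows "fraction A M S m s = fraction A M S m' s'"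
  using assms one_in_S by (auto simp: fraction_eq_iff)

lemma mem_fraction_iff:
  assumes "m \<in> carrier M" "s \<in> S"
  shows "(m', s') \<in> fraction A M S m s \<longleftrightarrow>
    m' \<in> carrier M \<and> s' \<in> S \<and> fraction A M S m' s' = fraction A M S m s"
proof -
  have "(m', s') \<in> fraction A M S m s \<longleftrightarrow> ((m', s'), (m, s)) \<in> frac_rel A M S"
    using equiv_frac_rel by (auto simp: fraction_def equiv_def sym_def)
  also have "\<dots> \<longleftrightarrow> m' \<in> carrier M \<and> s' \<in> S \<and> fraction A M S m' s' = fraction A M S m s"
    using assms fraction_eq_iff[of m' s' m s] by (auto simp: frac_rel_def)
  finally show ?thesis .
qed

lemma self_mem_fraction:
  "\<lbrakk>m \<in> carrier M; s \<in> S\<rbrakk> \<Longrightarrow> (m, s) \<in> fraction A M S m s"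
  by (simp add: mem_fraction_iff)

lemma loc_carrier:
  "carrier (loc_module A M S) = {fraction A M S m s | m s. m \<in> carrier M \<and> s \<in> S}"
  by (auto simp: loc_module_def quotient_def fraction_def)

lemma fraction_closed [simp]:
  "\<lbrakk>m \<in> carrier M; s \<in> S\<rbrakk> \<Longrightarrow> fraction A M S m s \<in> carrier (loc_module A M S)"
  by (auto simp: loc_carrier)

text \<open>
  The operations on fractions are unions over all representatives. Such a union is computed by
  showing that the family does not depend on the representative.
\<close>
lemma UN_fraction:
  assumes "m \<in> carrier M" "s \<in> S"
    and "\<And>m' s'. \<lbrakk>m' \<in> carrier M; s' \<in> S; fraction A M S m' s' = fraction A M S m s\<rbrakk> \<Longrightarrow> F m' s' = C"
  shows "(\<Union>(m', s')\<in>fraction A M S m s. F m' s') = C"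
proof -
  have "(case z of (m', s') \<Rightarrow> F m' s') = C" if "z \<in> fraction A M S m s" for z
    using that assms by (cases z) (simp add: mem_fraction_iff)
  then show ?thesis
    using self_mem_fraction[OF assms(1,2)] by auto
qed

lemma loc_add:
  assumes c: "m \<in> carrier M" "s \<in> S" "m' \<in> carrier M" "s' \<in> S"
  shows "fraction A M S m s \<oplus>\<^bsub>loc_module A M S\<^esub> fraction A M S m' s' =
    fraction A M S ((s' \<odot>\<^bsub>M\<^esub> m) \<oplus>\<^bsub>M\<^esub> (s \<odot>\<^bsub>M\<^esub> m')) (s \<otimes>\<^bsub>A\<^esub> s')"
proof -
  have "fraction A M S ((t' \<odot>\<^bsub>M\<^esub> n) \<oplus>\<^bsub>M\<^esub> (t \<odot>\<^bsub>M\<^esub> n')) (t \<otimes>\<^bsub>A\<^esub> t') =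
    fraction A M S ((s' \<odot>\<^bsub>M\<^esub> m) \<oplus>\<^bsub>M\<^esub> (s \<odot>\<^bsub>M\<^esub> m')) (s \<otimes>\<^bsub>A\<^esub> s')"
    if d: "n \<in> carrier M" "t \<in> S" "n' \<in> carrier M" "t' \<in> S"
      and e: "fraction A M S n t = fraction A M S m s"
             "fraction A M S n' t' = fraction A M S m' s'" for n t n' t'
  proof -
    obtain u where u: "u \<in> S" "u \<odot>\<^bsub>M\<^esub> (s \<odot>\<^bsub>M\<^esub> n) = u \<odot>\<^bsub>M\<^esub> (t \<odot>\<^bsub>M\<^esub> m)"
      using e(1) c d by (auto simp: fraction_eq_iff)
    obtain v where v: "v \<in> S" "v \<odot>\<^bsub>M\<^esub> (s' \<odot>\<^bsub>M\<^esub> n') = v \<odot>\<^bsub>M\<^esub> (t' \<odot>\<^bsub>M\<^esub> m')"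
      using e(2) c d by (auto simp: fraction_eq_iff)
    have 1: "(u \<otimes>\<^bsub>A\<^esub> v) \<odot>\<^bsub>M\<^esub> ((s \<otimes>\<^bsub>A\<^esub> s') \<odot>\<^bsub>M\<^esub> (t' \<odot>\<^bsub>M\<^esub> n)) =
        (u \<otimes>\<^bsub>A\<^esub> v) \<odot>\<^bsub>M\<^esub> ((t \<otimes>\<^bsub>A\<^esub> t') \<odot>\<^bsub>M\<^esub> (s' \<odot>\<^bsub>M\<^esub> m))"
    proof -
      have "(u \<otimes>\<^bsub>A\<^esub> v) \<odot>\<^bsub>M\<^esub> ((s \<otimes>\<^bsub>A\<^esub> s') \<odot>\<^bsub>M\<^esub> (t' \<odot>\<^bsub>M\<^esub> n)) = v \<odot>\<^bsub>M\<^esub> (s' \<odot>\<^bsub>M\<^esub> (t' \<odot>\<^bsub>M\<^esub> (u \<odot>\<^bsub>M\<^esub> (s \<odot>\<^bsub>M\<^esub> n))))"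
        using c d u(1) v(1) by (simp add: smult_assoc1 smult_left_commute)
      also have "\<dots> = (u \<otimes>\<^bsub>A\<^esub> v) \<odot>\<^bsub>M\<^esub> ((t \<otimes>\<^bsub>A\<^esub> t') \<odot>\<^bsub>M\<^esub> (s' \<odot>\<^bsub>M\<^esub> m))"
        unfolding u(2) using c d u(1) v(1) by (simp add: smult_assoc1 smult_left_commute)
      finally show ?thesis .
    qed
    have 2: "(u \<otimes>\<^bsub>A\<^esub> v) \<odot>\<^bsub>M\<^esub> ((s \<otimes>\<^bsub>A\<^esub> s') \<odot>\<^bsub>M\<^esub> (t \<odot>\<^bsub>M\<^esub> n')) =
        (u \<otimes>\<^bsub>A\<^esub> v) \<odot>\<^bsub>M\<^esub> ((t \<otimes>\<^bsub>A\<^esub> t') \<odot>\<^bsub>M\<^esub> (s \<odot>\<^bsub>M\<^esub> m'))"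
    proof -
      have "(u \<otimes>\<^bsub>A\<^esub> v) \<odot>\<^bsub>M\<^esub> ((s \<otimes>\<^bsub>A\<^esub> s') \<odot>\<^bsub>M\<^esub> (t \<odot>\<^bsub>M\<^esub> n')) = u \<odot>\<^bsub>M\<^esub> (s \<odot>\<^bsub>M\<^esub> (t \<odot>\<^bsub>M\<^esub> (v \<odot>\<^bsub>M\<^esub> (s' \<odot>\<^bsub>M\<^esub> n'))))"
        using c d u(1) v(1) by (simp add: smult_assoc1 smult_left_commute)
      also have "\<dots> = (u \<otimes>\<^bsub>A\<^esub> v) \<odot>\<^bsub>M\<^esub> ((t \<otimes>\<^bsub>A\<^esub> t') \<odot>\<^bsub>M\<^esub> (s \<odot>\<^bsub>M\<^esub> m'))"
        unfolding v(2) using c d u(1) v(1) by (simp add: smult_assoc1 smult_left_commute)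
      finally show ?thesis .
    qed
    show ?thesis
      using c d u(1) v(1) S_mult 1 2
      by (subst fraction_eq_iff) (auto simp: smult_r_distr intro!: bexI[of _ "u \<otimes>\<^bsub>A\<^esub> v"])
  qed
  note * = this
  show ?thesis
    unfolding loc_module_def
    by (simp, rule UN_fraction[OF c(1,2)], rule UN_fraction[OF c(3,4)], rule *)
qed

lemma loc_zero: "\<zero>\<^bsub>loc_module A M S\<^esub> = fraction A M S \<zero>\<^bsub>M\<^esub> \<one>\<^bsub>A\<^esub>"
  by (simp add: loc_module_def)

lemma loc_abelian_group: "abelian_group (loc_module A M S)"
proof (rule abelian_groupI)
  show "\<zero>\<^bsub>loc_module A M S\<^esub> \<in> carrier (loc_module A M S)"
    using one_in_S by (simp add: loc_zero)
next
  fix x y assume "x \<in> carrier (loc_module A M S)" "y \<in> carrier (loc_module A M S)"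
  then obtain m s m' s' where c: "m \<in> carrier M" "s \<in> S" "m' \<in> carrier M" "s' \<in> S"
    and x: "x = fraction A M S m s" and y: "y = fraction A M S m' s'"
    unfolding loc_carrier by blast
  show "x \<oplus>\<^bsub>loc_module A M S\<^esub> y \<in> carrier (loc_module A M S)"
    using c by (simp add: x y loc_add S_mult)
  show "x \<oplus>\<^bsub>loc_module A M S\<^esub> y = y \<oplus>\<^bsub>loc_module A M S\<^esub> x"
    using c by (simp add: x y loc_add M.a_comm R.m_comm)
next
  fix x y z assume "x \<in> carrier (loc_module A M S)" "y \<in> carrier (loc_module A M S)"
    "z \<in> carrier (loc_module A M S)"
  then obtain m s m' s' m'' s'' where c: "m \<in> carrier M" "s \<in> S" "m' \<in> carrier M" "s' \<in> S"
    "m'' \<in> carrier M" "s'' \<in> S"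
    and x: "x = fraction A M S m s" and y: "y = fraction A M S m' s'"
    and z: "z = fraction A M S m'' s''"
    unfolding loc_carrier by blast
  show "x \<oplus>\<^bsub>loc_module A M S\<^esub> y \<oplus>\<^bsub>loc_module A M S\<^esub> z =
      x \<oplus>\<^bsub>loc_module A M S\<^esub> (y \<oplus>\<^bsub>loc_module A M S\<^esub> z)"
    using c by (simp add: x y z loc_add S_mult smult_r_distr smult_assoc1 smult_left_commute
        M.a_assoc R.m_assoc)
next
  fix x assume "x \<in> carrier (loc_module A M S)"
  then obtain m s where c: "m \<in> carrier M" "s \<in> S" and x: "x = fraction A M S m s"
    unfolding loc_carrier by blast
  show "\<zero>\<^bsub>loc_module A M S\<^esub> \<oplus>\<^bsub>loc_module A M S\<^esub> x = x"
    using c one_in_S by (simp add: x loc_zero loc_add)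
  have "fraction A M S (\<ominus>\<^bsub>M\<^esub> m) s \<oplus>\<^bsub>loc_module A M S\<^esub> x = fraction A M S \<zero>\<^bsub>M\<^esub> (s \<otimes>\<^bsub>A\<^esub> s)"
    using c by (simp add: x loc_add smult_r_minus M.l_neg)
  also have "\<dots> = \<zero>\<^bsub>loc_module A M S\<^esub>"
    unfolding loc_zero using c one_in_S S_mult by (intro fraction_eqI) auto
  finally show "\<exists>y\<in>carrier (loc_module A M S). y \<oplus>\<^bsub>loc_module A M S\<^esub> x = \<zero>\<^bsub>loc_module A M S\<^esub>"
    using c by (intro bexI[of _ "fraction A M S (\<ominus>\<^bsub>M\<^esub> m) s"]) simp_all
qed

end

lemma self_module_simps [simp]:
  "carrier (self_module A) = carrier A"
  "add (self_module A) = add A"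
  "zero (self_module A) = zero A"
  "smult (self_module A) = mult A"
  by (simp_all add: self_module_def)

lemma (in localization) localization_self: "localization A (self_module A) S"
  using module_self[OF R.is_cring] S_subset one_in_S S_mult
  by (auto simp: localization_def localization_axioms_def)

lemma loc_ring_simps [simp]:
  "carrier (loc_ring A S) = carrier (loc_module A (self_module A) S)"
  "mult (loc_ring A S) = smult (loc_module A (self_module A) S)"
  "add (loc_ring A S) = add (loc_module A (self_module A) S)"
  "one (loc_ring A S) = fraction A (self_module A) S \<one>\<^bsub>A\<^esub> \<one>\<^bsub>A\<^esub>"
  "zero (loc_ring A S) = zero (loc_module A (self_module A) S)"
  by (simp_all add: loc_ring_def)

context localization
begin

interpretation self: localization A "self_module A" S
  by (rule localization_self)

lemma loc_smult:
  assumes c: "a \<in> carrier A" "s \<in> S" "m \<in> carrier M" "s' \<in> S"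
  shows "fraction A (self_module A) S a s \<odot>\<^bsub>loc_module A M S\<^esub> fraction A M S m s' =
    fraction A M S (a \<odot>\<^bsub>M\<^esub> m) (s \<otimes>\<^bsub>A\<^esub> s')"
proof -
  have "fraction A M S (b \<odot>\<^bsub>M\<^esub> n) (t \<otimes>\<^bsub>A\<^esub> t') = fraction A M S (a \<odot>\<^bsub>M\<^esub> m) (s \<otimes>\<^bsub>A\<^esub> s')"
    if d: "b \<in> carrier A" "t \<in> S" "n \<in> carrier M" "t' \<in> S"
      and e: "fraction A (self_module A) S b t = fraction A (self_module A) S a s"
             "fraction A M S n t' = fraction A M S m s'" for b t n t'
  proof -
    obtain u where u: "u \<in> S" "u \<otimes>\<^bsub>A\<^esub> (s \<otimes>\<^bsub>A\<^esub> b) = u \<otimes>\<^bsub>A\<^esub> (t \<otimes>\<^bsub>A\<^esub> a)"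
      using e(1) c d by (auto simp: self.fraction_eq_iff)
    obtain v where v: "v \<in> S" "v \<odot>\<^bsub>M\<^esub> (s' \<odot>\<^bsub>M\<^esub> n) = v \<odot>\<^bsub>M\<^esub> (t' \<odot>\<^bsub>M\<^esub> m)"
      using e(2) c d by (auto simp: fraction_eq_iff)
    have "(u \<otimes>\<^bsub>A\<^esub> v) \<odot>\<^bsub>M\<^esub> ((s \<otimes>\<^bsub>A\<^esub> s') \<odot>\<^bsub>M\<^esub> (b \<odot>\<^bsub>M\<^esub> n)) =
        (u \<otimes>\<^bsub>A\<^esub> (s \<otimes>\<^bsub>A\<^esub> b)) \<odot>\<^bsub>M\<^esub> (v \<odot>\<^bsub>M\<^esub> (s' \<odot>\<^bsub>M\<^esub> n))"
      using c d u(1) v(1) by (simp add: smult_assoc1 smult_left_commute)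
    also have "\<dots> = (u \<otimes>\<^bsub>A\<^esub> v) \<odot>\<^bsub>M\<^esub> ((t \<otimes>\<^bsub>A\<^esub> t') \<odot>\<^bsub>M\<^esub> (a \<odot>\<^bsub>M\<^esub> m))"
      unfolding u(2) v(2) using c d u(1) v(1) by (simp add: smult_assoc1 smult_left_commute)
    finally show ?thesis
      using c d u(1) v(1) S_mult
      by (subst fraction_eq_iff) (auto intro!: bexI[of _ "u \<otimes>\<^bsub>A\<^esub> v"])
  qed
  note * = this
  show ?thesis
    unfolding loc_module_def[of A M S] using c(1)
    by (simp, intro self.UN_fraction[OF _ c(2)] UN_fraction[OF c(3,4)] *) simp_all
qed

end

context localization
begin

interpretation self: localization A "self_module A" S
  by (rule localization_self)

lemma loc_ring_cring: "cring (loc_ring A S)"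
proof (rule cringI)
  interpret L: abelian_group "loc_module A (self_module A) S"
    by (rule self.loc_abelian_group)
  show "abelian_group (loc_ring A S)"
    by (rule abelian_groupI) (auto simp: L.a_ac intro: L.l_neg)
  show "comm_monoid (loc_ring A S)"
  proof (rule comm_monoidI)
    fix x y assume "x \<in> carrier (loc_ring A S)" "y \<in> carrier (loc_ring A S)"
    then obtain a s b t where c: "a \<in> carrier A" "s \<in> S" "b \<in> carrier A" "t \<in> S"
      and x: "x = fraction A (self_module A) S a s" and y: "y = fraction A (self_module A) S b t"
      unfolding loc_ring_simps self.loc_carrier self_module_simps by blast
    show "x \<otimes>\<^bsub>loc_ring A S\<^esub> y \<in> carrier (loc_ring A S)"
      using c by (simp add: x y self.loc_smult S_mult)
    show "x \<otimes>\<^bsub>loc_ring A S\<^esub> y = y \<otimes>\<^bsub>loc_ring A S\<^esub> x"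
      using c by (simp add: x y self.loc_smult R.m_comm)
  next
    fix x y z assume "x \<in> carrier (loc_ring A S)" "y \<in> carrier (loc_ring A S)" "z \<in> carrier (loc_ring A S)"
    then obtain a s b t d u where c: "a \<in> carrier A" "s \<in> S" "b \<in> carrier A" "t \<in> S"
        "d \<in> carrier A" "u \<in> S"
      and x: "x = fraction A (self_module A) S a s" and y: "y = fraction A (self_module A) S b t"
      and z: "z = fraction A (self_module A) S d u"
      unfolding loc_ring_simps self.loc_carrier self_module_simps by blast
    show "x \<otimes>\<^bsub>loc_ring A S\<^esub> y \<otimes>\<^bsub>loc_ring A S\<^esub> z = x \<otimes>\<^bsub>loc_ring A S\<^esub> (y \<otimes>\<^bsub>loc_ring A S\<^esub> z)"
      using c by (simp add: x y z self.loc_smult S_mult R.m_assoc)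
  next
    fix x assume "x \<in> carrier (loc_ring A S)"
    then obtain a s where c: "a \<in> carrier A" "s \<in> S" and x: "x = fraction A (self_module A) S a s"
      unfolding loc_ring_simps self.loc_carrier self_module_simps by blast
    show "\<one>\<^bsub>loc_ring A S\<^esub> \<otimes>\<^bsub>loc_ring A S\<^esub> x = x"
      using c one_in_S by (simp add: x self.loc_smult)
  qed (use one_in_S in simp)
next
  fix x y z assume "x \<in> carrier (loc_ring A S)" "y \<in> carrier (loc_ring A S)" "z \<in> carrier (loc_ring A S)"
  then obtain a s b t d u where c: "a \<in> carrier A" "s \<in> S" "b \<in> carrier A" "t \<in> S"
      "d \<in> carrier A" "u \<in> S"
    and x: "x = fraction A (self_module A) S a s" and y: "y = fraction A (self_module A) S b t"
    and z: "z = fraction A (self_module A) S d u"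
    unfolding loc_ring_simps self.loc_carrier self_module_simps by blast
  have "u \<in> carrier A" "t \<in> carrier A" "s \<in> carrier A" using c by auto
  then show "(x \<oplus>\<^bsub>loc_ring A S\<^esub> y) \<otimes>\<^bsub>loc_ring A S\<^esub> z =
      x \<otimes>\<^bsub>loc_ring A S\<^esub> z \<oplus>\<^bsub>loc_ring A S\<^esub> y \<otimes>\<^bsub>loc_ring A S\<^esub> z"
    using c by (simp add: x y z self.loc_smult self.loc_add S_mult)
      (rule self.fraction_eqI, auto simp: S_mult R.l_distr R.r_distr R.m_ac)
qed

lemma loc_module_module: "module (loc_ring A S) (loc_module A M S)"
proof (rule moduleI)
  show "cring (loc_ring A S)" by (rule loc_ring_cring)
  show "abelian_group (loc_module A M S)" by (rule loc_abelian_group)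
next
  fix x z assume "x \<in> carrier (loc_ring A S)" "z \<in> carrier (loc_module A M S)"
  then obtain a s m t where c: "a \<in> carrier A" "s \<in> S" "m \<in> carrier M" "t \<in> S"
    and x: "x = fraction A (self_module A) S a s" and z: "z = fraction A M S m t"
    unfolding loc_ring_simps loc_carrier self.loc_carrier self_module_simps by blast
  show "x \<odot>\<^bsub>loc_module A M S\<^esub> z \<in> carrier (loc_module A M S)"
    using c by (simp add: x z loc_smult S_mult)
next
  fix x y z assume "x \<in> carrier (loc_ring A S)" "y \<in> carrier (loc_ring A S)" "z \<in> carrier (loc_module A M S)"
  then obtain a s b t m u where c: "a \<in> carrier A" "s \<in> S" "b \<in> carrier A" "t \<in> S"
      "m \<in> carrier M" "u \<in> S"
    and x: "x = fraction A (self_module A) S a s" and y: "y = fraction A (self_module A) S b t"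
    and z: "z = fraction A M S m u"
    unfolding loc_ring_simps loc_carrier self.loc_carrier self_module_simps by blast
  show "(x \<otimes>\<^bsub>loc_ring A S\<^esub> y) \<odot>\<^bsub>loc_module A M S\<^esub> z = x \<odot>\<^bsub>loc_module A M S\<^esub> (y \<odot>\<^bsub>loc_module A M S\<^esub> z)"
    using c by (simp add: x y z loc_smult self.loc_smult S_mult R.m_assoc smult_assoc1)
  show "(x \<oplus>\<^bsub>loc_ring A S\<^esub> y) \<odot>\<^bsub>loc_module A M S\<^esub> z =
      x \<odot>\<^bsub>loc_module A M S\<^esub> z \<oplus>\<^bsub>loc_module A M S\<^esub> y \<odot>\<^bsub>loc_module A M S\<^esub> z"
    using c by (simp add: x y z loc_smult self.loc_add loc_add S_mult)
      (rule fraction_eqI, auto simp: smult_l_distr smult_r_distr S_mult smult_assoc1 smult_left_commute)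
next
  fix x y z assume "x \<in> carrier (loc_ring A S)" "y \<in> carrier (loc_module A M S)" "z \<in> carrier (loc_module A M S)"
  then obtain a s m t m' u where c: "a \<in> carrier A" "s \<in> S" "m \<in> carrier M" "t \<in> S"
      "m' \<in> carrier M" "u \<in> S"
    and x: "x = fraction A (self_module A) S a s" and y: "y = fraction A M S m t"
    and z: "z = fraction A M S m' u"
    unfolding loc_ring_simps loc_carrier self.loc_carrier self_module_simps by blast
  show "x \<odot>\<^bsub>loc_module A M S\<^esub> (y \<oplus>\<^bsub>loc_module A M S\<^esub> z) =
      x \<odot>\<^bsub>loc_module A M S\<^esub> y \<oplus>\<^bsub>loc_module A M S\<^esub> x \<odot>\<^bsub>loc_module A M S\<^esub> z"
    using c by (simp add: x y z loc_smult loc_add S_mult)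
      (rule fraction_eqI, auto simp: smult_l_distr smult_r_distr S_mult smult_assoc1 smult_left_commute)
next
  fix z assume "z \<in> carrier (loc_module A M S)"
  then obtain m t where c: "m \<in> carrier M" "t \<in> S" and z: "z = fraction A M S m t"
    unfolding loc_carrier by blast
  show "\<one>\<^bsub>loc_ring A S\<^esub> \<odot>\<^bsub>loc_module A M S\<^esub> z = z"
    using c one_in_S by (simp add: z loc_smult)
qed

end

lemma localization_prime:
  assumes "module A M" "primeideal p A"
  shows "localization A M (carrier A - p)"
proof -
  interpret module A M by fact
  interpret p: primeideal p A by fact
  have "\<one>\<^bsub>A\<^esub> \<notin> p" using p.one_imp_carrier p.I_notcarr by auto
  then show ?thesis
    using p.I_prime assms(1) by (auto simp: localization_def localization_axioms_def)
qed

section \<open>Free modules and traces\<close>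

text \<open>
  A basis element has a linear coordinate function, which takes the value \<open>1\<close> there. In
  this form freeness enters the proof of (3) from (1).
\<close>
lemma module_basis_coordinate:
  fixes A :: "'a ring" and M :: "('a, 'b) module"
  assumes "module A M" and basis: "module_basis A M B" and b: "b \<in> B"
  obtains f where "f \<in> mod_homs A M (self_module A)" "f b = \<one>\<^bsub>A\<^esub>"
proof -
  interpret module A M by fact
  have B: "B \<subseteq> carrier M"
    using basis by (simp add: module_basis_def)
  \<comment> \<open>Coefficient families are extended by zero, so that two representations of an element
    can be compared on the union of their supports.\<close>
  define rep where "rep x H d \<longleftrightarrow> finite H \<and> H \<subseteq> B \<and> (\<forall>i. d i \<in> carrier A) \<and>
      (\<forall>i. i \<notin> H \<longrightarrow> d i = \<zero>\<^bsub>A\<^esub>) \<and> x = (\<Oplus>\<^bsub>M\<^esub>i\<in>H. d i \<odot>\<^bsub>M\<^esub> i)" for x H d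
  have rep_mono: "rep x H' d" if r: "rep x H d" and H': "finite H'" "H \<subseteq> H'" "H' \<subseteq> B" for x H H' d
  proof -
    have "(\<Oplus>\<^bsub>M\<^esub>i\<in>H. d i \<odot>\<^bsub>M\<^esub> i) = (\<Oplus>\<^bsub>M\<^esub>i\<in>H'. d i \<odot>\<^bsub>M\<^esub> i)"
      using r H' B by (intro M.add.finprod_mono_neutral_cong_left) (auto simp: rep_def)
    with r H' show ?thesis by (auto simp: rep_def)
  qed
  have rep_add: "rep (x \<oplus>\<^bsub>M\<^esub> y) (H \<union> H') (\<lambda>i. d i \<oplus>\<^bsub>A\<^esub> e i)"
    if "rep x H d" "rep y H' e" for x y H H' d e
  proof -
    have r: "rep x (H \<union> H') d" "rep y (H \<union> H') e"
      by (rule rep_mono[OF that(1)] rep_mono[OF that(2)]; use that in \<open>simp add: rep_def\<close>)+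
    have "(\<Oplus>\<^bsub>M\<^esub>i\<in>H \<union> H'. (d i \<oplus>\<^bsub>A\<^esub> e i) \<odot>\<^bsub>M\<^esub> i) =
        (\<Oplus>\<^bsub>M\<^esub>i\<in>H \<union> H'. d i \<odot>\<^bsub>M\<^esub> i \<oplus>\<^bsub>M\<^esub> e i \<odot>\<^bsub>M\<^esub> i)"
      using r B by (intro M.finsum_cong') (auto simp: rep_def smult_l_distr)
    also have "\<dots> = x \<oplus>\<^bsub>M\<^esub> y"
      using r B by (subst M.finsum_addf) (auto simp: rep_def)
    finally show ?thesis using r by (auto simp: rep_def)
  qed
  have rep_smult: "rep (a \<odot>\<^bsub>M\<^esub> x) H (\<lambda>i. a \<otimes>\<^bsub>A\<^esub> d i)"
    if r: "rep x H d" and a: "a \<in> carrier A" for a x H d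
  proof -
    have "(\<Oplus>\<^bsub>M\<^esub>i\<in>H. (a \<otimes>\<^bsub>A\<^esub> d i) \<odot>\<^bsub>M\<^esub> i) = (\<Oplus>\<^bsub>M\<^esub>i\<in>H. a \<odot>\<^bsub>M\<^esub> (d i \<odot>\<^bsub>M\<^esub> i))"
      using r a B by (intro M.finsum_cong') (auto simp: rep_def smult_assoc1)
    also have "\<dots> = a \<odot>\<^bsub>M\<^esub> x"
      using r a B by (subst finsum_smult_ldistr[symmetric]) (auto simp: rep_def)
    finally show ?thesis using r a by (auto simp: rep_def)
  qed
  have rep_ex: "\<exists>H d. rep x H d" if x: "x \<in> carrier M" for x
  proof -
    obtain F c where F: "finite F" "F \<subseteq> B" "c \<in> F \<rightarrow> carrier A" "x = (\<Oplus>\<^bsub>M\<^esub>i\<in>F. c i \<odot>\<^bsub>M\<^esub> i)"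
      using basis x unfolding module_basis_def by metis
    define d where "d i = (if i \<in> F then c i else \<zero>\<^bsub>A\<^esub>)" for i
    have "(\<Oplus>\<^bsub>M\<^esub>i\<in>F. d i \<odot>\<^bsub>M\<^esub> i) = (\<Oplus>\<^bsub>M\<^esub>i\<in>F. c i \<odot>\<^bsub>M\<^esub> i)"
      using F B by (intro M.finsum_cong') (auto simp: d_def)
    then have "rep x F d" using F by (auto simp: rep_def d_def)
    then show ?thesis by blast
  qed
  have rep_carrier: "x \<in> carrier M" if "rep x H d" for x H d
    using that B by (auto simp: rep_def intro!: M.finsum_closed)
  have rep_unique: "d b = e b" if r: "rep x H d" "rep x H' e" for x H H' d e
  proof -
    have m: "\<ominus>\<^bsub>A\<^esub> \<one>\<^bsub>A\<^esub> \<in> carrier A" by simp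
    have x: "x \<in> carrier M" using r rep_carrier by blast
    \<comment> \<open>The difference of two representations represents zero.\<close>
    have "rep (x \<oplus>\<^bsub>M\<^esub> (\<ominus>\<^bsub>A\<^esub> \<one>\<^bsub>A\<^esub>) \<odot>\<^bsub>M\<^esub> x) (H \<union> H') (\<lambda>i. d i \<oplus>\<^bsub>A\<^esub> (\<ominus>\<^bsub>A\<^esub> \<one>\<^bsub>A\<^esub>) \<otimes>\<^bsub>A\<^esub> e i)"
      by (intro rep_add rep_smult r m)
    moreover have "x \<oplus>\<^bsub>M\<^esub> (\<ominus>\<^bsub>A\<^esub> \<one>\<^bsub>A\<^esub>) \<odot>\<^bsub>M\<^esub> x = \<zero>\<^bsub>M\<^esub>"
      using x by (simp add: smult_l_minus M.r_neg)
    ultimately have z: "rep \<zero>\<^bsub>M\<^esub> (H \<union> H') (\<lambda>i. d i \<oplus>\<^bsub>A\<^esub> (\<ominus>\<^bsub>A\<^esub> \<one>\<^bsub>A\<^esub>) \<otimes>\<^bsub>A\<^esub> e i)"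
      by simp
    have indep: "\<forall>i\<in>F. c i = \<zero>\<^bsub>A\<^esub>" if "finite F" "F \<subseteq> B" "c \<in> F \<rightarrow> carrier A"
      "(\<Oplus>\<^bsub>M\<^esub>i\<in>F. c i \<odot>\<^bsub>M\<^esub> i) = \<zero>\<^bsub>M\<^esub>" for F c
      using basis that unfolding module_basis_def by blast
    have "\<forall>i\<in>H \<union> H'. d i \<oplus>\<^bsub>A\<^esub> (\<ominus>\<^bsub>A\<^esub> \<one>\<^bsub>A\<^esub>) \<otimes>\<^bsub>A\<^esub> e i = \<zero>\<^bsub>A\<^esub>"
      by (rule indep) (use z in \<open>auto simp: rep_def\<close>)
    then have "d b \<oplus>\<^bsub>A\<^esub> (\<ominus>\<^bsub>A\<^esub> \<one>\<^bsub>A\<^esub>) \<otimes>\<^bsub>A\<^esub> e b = \<zero>\<^bsub>A\<^esub>"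
      using z by (cases "b \<in> H \<union> H'") (auto simp: rep_def)
    moreover have "d b \<in> carrier A" "e b \<in> carrier A" using r by (auto simp: rep_def)
    ultimately show ?thesis
      by (simp add: R.l_minus) (metis R.minus_equality R.add.inv_closed R.minus_minus)
  qed
  define f where "f x = (SOME r. \<exists>H d. rep x H d \<and> r = d b)" for x
  have f_eq: "f x = d b" if "rep x H d" for x H d
    unfolding f_def using that rep_unique by (intro some_equality) blast+
  have "f \<in> mod_homs A M (self_module A)"
    unfolding mod_homs_def
  proof (intro CollectI conjI ballI Pi_I)
    fix x assume "x \<in> carrier M"
    then obtain H d where r: "rep x H d" using rep_ex by blast
    then show "f x \<in> carrier (self_module A)"
      by (auto simp: f_eq rep_def)
    fix y assume "y \<in> carrier M"
    then obtain H' e where r': "rep y H' e" using rep_ex by blast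
    show "f (x \<oplus>\<^bsub>M\<^esub> y) = f x \<oplus>\<^bsub>self_module A\<^esub> f y"
      using f_eq[OF r] f_eq[OF r'] f_eq[OF rep_add[OF r r']] by simp
  next
    fix a x assume a: "a \<in> carrier A" and "x \<in> carrier M"
    then obtain H d where r: "rep x H d" using rep_ex by blast
    show "f (a \<odot>\<^bsub>M\<^esub> x) = a \<odot>\<^bsub>self_module A\<^esub> f x"
      using f_eq[OF r] f_eq[OF rep_smult[OF r a]] by simp
  qed
  moreover have "rep b {b} (\<lambda>i. if i = b then \<one>\<^bsub>A\<^esub> else \<zero>\<^bsub>A\<^esub>)"
    using b B by (auto simp: rep_def)
  then have "f b = \<one>\<^bsub>A\<^esub>"
    using f_eq by fastforce
  ultimately show ?thesis using that by blast
qed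

lemma mod_homsD:
  assumes "f \<in> mod_homs A M N"
  shows "x \<in> carrier M \<Longrightarrow> f x \<in> carrier N"
    and "x \<in> carrier M \<Longrightarrow> y \<in> carrier M \<Longrightarrow> f (x \<oplus>\<^bsub>M\<^esub> y) = f x \<oplus>\<^bsub>N\<^esub> f y"
    and "a \<in> carrier A \<Longrightarrow> x \<in> carrier M \<Longrightarrow> f (a \<odot>\<^bsub>M\<^esub> x) = a \<odot>\<^bsub>N\<^esub> f x"
  using assms by (auto simp: mod_homs_def)

lemma mod_homs_zero:
  assumes "module A M" and f: "f \<in> mod_homs A M (self_module A)"
  shows "f \<zero>\<^bsub>M\<^esub> = \<zero>\<^bsub>A\<^esub>"
proof -
  interpret module A M by fact
  have "f (\<zero>\<^bsub>A\<^esub> \<odot>\<^bsub>M\<^esub> \<zero>\<^bsub>M\<^esub>) = \<zero>\<^bsub>A\<^esub> \<otimes>\<^bsub>A\<^esub> f \<zero>\<^bsub>M\<^esub>"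
    using mod_homsD(3)[OF f R.zero_closed M.zero_closed] by simp
  then show ?thesis
    using mod_homsD(1)[OF f, of "\<zero>\<^bsub>M\<^esub>"] by simp
qed

text \<open>
  A sum indexed by two sets of homomorphisms must assign a single argument to a homomorphism
  that occurs in both; additivity allows the two arguments to be added.
\<close>
lemma module_trace_ideal:
  fixes A :: "'a ring" and M :: "('a, 'b) module"
  assumes "module A M"
  shows "ideal (module_trace A M) A"
proof -
  interpret module A M by fact
  let ?H = "mod_homs A M (self_module A)"
  have hom: "f (x f) \<in> carrier A" if "f \<in> F" "F \<subseteq> ?H" "x \<in> F \<rightarrow> carrier M" for f F x
    using that mod_homsD(1)[of f A M "self_module A" "x f"] by auto
  have traceI: "(\<Oplus>\<^bsub>A\<^esub>f\<in>F. f (x f)) \<in> module_trace A M"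
    if "finite F" "F \<subseteq> ?H" "x \<in> F \<rightarrow> carrier M" for F x
    using that unfolding module_trace_def by blast
  have sub: "module_trace A M \<subseteq> carrier A"
    using hom by (auto simp: module_trace_def intro!: R.finsum_closed)
  have smult: "a \<otimes>\<^bsub>A\<^esub> t \<in> module_trace A M" if a: "a \<in> carrier A" and t: "t \<in> module_trace A M" for a t
  proof -
    obtain F x where F: "finite F" "F \<subseteq> ?H" "x \<in> F \<rightarrow> carrier M" and t: "t = (\<Oplus>\<^bsub>A\<^esub>f\<in>F. f (x f))"
      using t unfolding module_trace_def by blast
    have "a \<otimes>\<^bsub>A\<^esub> t = (\<Oplus>\<^bsub>A\<^esub>f\<in>F. a \<otimes>\<^bsub>A\<^esub> f (x f))"
      unfolding t using F a hom by (intro R.finsum_rdistr) auto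
    also have "\<dots> = (\<Oplus>\<^bsub>A\<^esub>f\<in>F. f (a \<odot>\<^bsub>M\<^esub> x f))"
    proof (rule R.finsum_cong')
      fix f assume f: "f \<in> F"
      then have "f \<in> ?H" "x f \<in> carrier M" using F by auto
      then show "a \<otimes>\<^bsub>A\<^esub> f (x f) = f (a \<odot>\<^bsub>M\<^esub> x f)"
        using mod_homsD(3)[of f A M "self_module A" a "x f"] a by simp
    next
      have "(\<lambda>f. a \<odot>\<^bsub>M\<^esub> x f) \<in> F \<rightarrow> carrier M" using F a by auto
      then show "(\<lambda>f. f (a \<odot>\<^bsub>M\<^esub> x f)) \<in> F \<rightarrow> carrier A"
        using hom[OF _ F(2)] by blast
    qed simp
    also have "\<dots> \<in> module_trace A M"
      using F a by (intro traceI) auto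
    finally show ?thesis .
  qed
  have add: "t \<oplus>\<^bsub>A\<^esub> t' \<in> module_trace A M" if tt: "t \<in> module_trace A M" "t' \<in> module_trace A M" for t t'
  proof -
    obtain F x where F: "finite F" "F \<subseteq> ?H" "x \<in> F \<rightarrow> carrier M" and t: "t = (\<Oplus>\<^bsub>A\<^esub>f\<in>F. f (x f))"
      using tt(1) unfolding module_trace_def by blast
    obtain F' x' where F': "finite F'" "F' \<subseteq> ?H" "x' \<in> F' \<rightarrow> carrier M"
      and t': "t' = (\<Oplus>\<^bsub>A\<^esub>f\<in>F'. f (x' f))"
      using tt(2) unfolding module_trace_def by blast
    define y where "y f = (if f \<in> F then x f else \<zero>\<^bsub>M\<^esub>)" for f
    define y' where "y' f = (if f \<in> F' then x' f else \<zero>\<^bsub>M\<^esub>)" for f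
    have y: "y \<in> F \<union> F' \<rightarrow> carrier M" "y' \<in> F \<union> F' \<rightarrow> carrier M"
      using F F' by (auto simp: y_def y'_def)
    have FF: "F \<union> F' \<subseteq> ?H" using F F' by auto
    have zero: "f \<zero>\<^bsub>M\<^esub> = \<zero>\<^bsub>A\<^esub>" if "f \<in> F \<union> F'" for f
      using that FF by (intro mod_homs_zero[OF assms]) auto
    have "t = (\<Oplus>\<^bsub>A\<^esub>f\<in>F \<union> F'. f (y f))"
      unfolding t using F F' hom[OF _ FF y(1)] hom[OF _ F(2,3)]
      by (intro R.add.finprod_mono_neutral_cong_left) (auto simp: y_def zero)
    moreover have "t' = (\<Oplus>\<^bsub>A\<^esub>f\<in>F \<union> F'. f (y' f))"
      unfolding t' using F F' hom[OF _ FF y(2)] hom[OF _ F'(2,3)]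
      by (intro R.add.finprod_mono_neutral_cong_left) (auto simp: y'_def zero)
    ultimately have "t \<oplus>\<^bsub>A\<^esub> t' = (\<Oplus>\<^bsub>A\<^esub>f\<in>F \<union> F'. f (y f) \<oplus>\<^bsub>A\<^esub> f (y' f))"
      using hom[OF _ FF y(1)] hom[OF _ FF y(2)] by (subst R.finsum_addf) auto
    also have "\<dots> = (\<Oplus>\<^bsub>A\<^esub>f\<in>F \<union> F'. f (y f \<oplus>\<^bsub>M\<^esub> y' f))"
    proof (rule R.finsum_cong')
      fix f assume f: "f \<in> F \<union> F'"
      then have "f \<in> ?H" "y f \<in> carrier M" "y' f \<in> carrier M" using FF y by auto
      then show "f (y f) \<oplus>\<^bsub>A\<^esub> f (y' f) = f (y f \<oplus>\<^bsub>M\<^esub> y' f)"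
        using mod_homsD(2)[of f A M "self_module A" "y f" "y' f"] by simp
    next
      have "(\<lambda>f. y f \<oplus>\<^bsub>M\<^esub> y' f) \<in> F \<union> F' \<rightarrow> carrier M" using y by auto
      then show "(\<lambda>f. f (y f \<oplus>\<^bsub>M\<^esub> y' f)) \<in> F \<union> F' \<rightarrow> carrier A"
        using hom[OF _ FF] by blast
    qed simp
    also have "\<dots> \<in> module_trace A M"
      using F F' FF y by (intro traceI) auto
    finally show ?thesis .
  qed
  show ?thesis
  proof (rule idealI)
    show "subgroup (module_trace A M) (add_monoid A)"
    proof (rule R.add.subgroupI)
      show "module_trace A M \<noteq> {}" using traceI[of "{}"] by auto
      fix t assume t: "t \<in> module_trace A M"
      then have "\<ominus>\<^bsub>A\<^esub> t = (\<ominus>\<^bsub>A\<^esub> \<one>\<^bsub>A\<^esub>) \<otimes>\<^bsub>A\<^esub> t"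
        using sub by (auto simp: R.l_minus)
      then show "\<ominus>\<^bsub>A\<^esub> t \<in> module_trace A M"
        using smult[OF _ t] by simp
    qed (use sub add in auto)
    fix t a assume t: "t \<in> module_trace A M" and a: "a \<in> carrier A"
    show "a \<otimes>\<^bsub>A\<^esub> t \<in> module_trace A M"
      by (rule smult[OF a t])
    then show "t \<otimes>\<^bsub>A\<^esub> a \<in> module_trace A M"
      using R.m_comm[OF a subsetD[OF sub t]] by simp
  qed (rule R.ring_axioms)
qed

lemma hom_value_in_trace:
  assumes "module A M" "f \<in> mod_homs A M (self_module A)" "x \<in> carrier M"
  shows "f x \<in> module_trace A M"
proof -
  interpret module A M by fact
  have "f x = (\<Oplus>\<^bsub>A\<^esub>g\<in>{f}. g x)"
    using assms mod_homsD(1)[OF assms(2,3)] by simp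
  moreover have "finite {f}" "{f} \<subseteq> mod_homs A M (self_module A)" "(\<lambda>_. x) \<in> {f} \<rightarrow> carrier M"
    using assms by auto
  ultimately show ?thesis
    unfolding module_trace_def mem_Collect_eq
    by (intro exI[of _ "{f}"] exI[of _ "\<lambda>_. x"] conjI)
qed

lemma trace_subset_ideal:
  assumes "module A M" "ideal p A"
    and "\<And>f x. f \<in> mod_homs A M (self_module A) \<Longrightarrow> x \<in> carrier M \<Longrightarrow> f x \<in> p"
  shows "module_trace A M \<subseteq> p"
proof -
  interpret module A M by fact
  interpret p: ideal p A by fact
  have "(\<Oplus>\<^bsub>A\<^esub>f\<in>F. f (x f)) \<in> p"
    if "finite F" "F \<subseteq> mod_homs A M (self_module A)" "x \<in> F \<rightarrow> carrier M" for F x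
    using that
  proof induction
    case (insert f F)
    then have *: "f (x f) \<in> p" "\<And>g. g \<in> F \<Longrightarrow> g (x g) \<in> p" by (auto intro!: assms(3))
    then have "(\<Oplus>\<^bsub>A\<^esub>g\<in>insert f F. g (x g)) = f (x f) \<oplus>\<^bsub>A\<^esub> (\<Oplus>\<^bsub>A\<^esub>g\<in>F. g (x g))"
      using insert p.a_subset by (subst R.finsum_insert) auto
    with * insert show ?case by simp
  qed simp
  then show ?thesis by (auto simp: module_trace_def)
qed

text \<open>
  Torsion-freeness of \<open>x\<close> is asked before localization; it passes to fractions because a relation
  \<open>(a / s) * (x / 1) = 0\<close> means \<open>(u * a) * x = 0\<close> for some denominator \<open>u\<close>.
\<close>
lemma (in localization) free_if_generator:
  assumes x: "x \<in> carrier M"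
    and gen: "\<And>y. y \<in> carrier M \<Longrightarrow> \<exists>s\<in>S. \<exists>a\<in>carrier A. s \<odot>\<^bsub>M\<^esub> y = a \<odot>\<^bsub>M\<^esub> x"
    and indep: "\<And>a. \<lbrakk>a \<in> carrier A; a \<odot>\<^bsub>M\<^esub> x = \<zero>\<^bsub>M\<^esub>\<rbrakk> \<Longrightarrow> a = \<zero>\<^bsub>A\<^esub>"
  shows "free_module (loc_ring A S) (loc_module A M S)"
proof -
  interpret self: localization A "self_module A" S
    by (rule localization_self)
  interpret L: module "loc_ring A S" "loc_module A M S"
    by (rule loc_module_module)
  let ?b = "fraction A M S x \<one>\<^bsub>A\<^esub>"
  have b: "?b \<in> carrier (loc_module A M S)"
    using x one_in_S by simp
  have span: "\<exists>F c. finite F \<and> F \<subseteq> {?b} \<and> c \<in> F \<rightarrow> carrier (loc_ring A S) \<and>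
      z = (\<Oplus>\<^bsub>loc_module A M S\<^esub>b\<in>F. c b \<odot>\<^bsub>loc_module A M S\<^esub> b)"
    if z: "z \<in> carrier (loc_module A M S)" for z
  proof -
    obtain y t where y: "y \<in> carrier M" "t \<in> S" and z: "z = fraction A M S y t"
      using z unfolding loc_carrier by blast
    obtain s a where s: "s \<in> S" "a \<in> carrier A" and e: "s \<odot>\<^bsub>M\<^esub> y = a \<odot>\<^bsub>M\<^esub> x"
      using gen[OF y(1)] by blast
    let ?c = "fraction A (self_module A) S a (s \<otimes>\<^bsub>A\<^esub> t)"
    have c: "?c \<in> carrier (loc_ring A S)" using s y S_mult by simp
    have "(s \<otimes>\<^bsub>A\<^esub> t) \<odot>\<^bsub>M\<^esub> y = t \<odot>\<^bsub>M\<^esub> (s \<odot>\<^bsub>M\<^esub> y)"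
      using s y by (simp add: smult_assoc1 smult_left_commute)
    then have "z = ?c \<odot>\<^bsub>loc_module A M S\<^esub> ?b"
      unfolding z using s y x S_mult one_in_S e
      by (subst loc_smult; simp) (rule fraction_eqI; simp)
    then show ?thesis
      using b c L.smult_closed[OF c b] by (intro exI[of _ "{?b}"] exI[of _ "\<lambda>_. ?c"]) simp
  qed
  have independent: "c b = \<zero>\<^bsub>loc_ring A S\<^esub>"
    if F: "finite F" "F \<subseteq> {?b}" "c \<in> F \<rightarrow> carrier (loc_ring A S)"
      and 0: "(\<Oplus>\<^bsub>loc_module A M S\<^esub>b\<in>F. c b \<odot>\<^bsub>loc_module A M S\<^esub> b) = \<zero>\<^bsub>loc_module A M S\<^esub>"
      and "b \<in> F" for F c b
  proof -
    have F: "F = {?b}" "b = ?b" "c ?b \<in> carrier (loc_ring A S)" using F \<open>b \<in> F\<close> by auto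
    then obtain a s where a: "a \<in> carrier A" "s \<in> S" and c: "c ?b = fraction A (self_module A) S a s"
      unfolding loc_ring_simps self.loc_carrier self_module_simps by blast
    have "\<zero>\<^bsub>loc_module A M S\<^esub> = c ?b \<odot>\<^bsub>loc_module A M S\<^esub> ?b"
      using 0 L.smult_closed[OF F(3) b] by (simp add: F(1))
    then have "fraction A M S \<zero>\<^bsub>M\<^esub> \<one>\<^bsub>A\<^esub> = fraction A M S (a \<odot>\<^bsub>M\<^esub> x) s"
      using a x one_in_S by (simp add: c loc_smult loc_zero)
    then obtain u where u: "u \<in> S" "u \<odot>\<^bsub>M\<^esub> (a \<odot>\<^bsub>M\<^esub> x) = \<zero>\<^bsub>M\<^esub>"
      using a x one_in_S by (auto simp: fraction_eq_iff)
    then have "u \<otimes>\<^bsub>A\<^esub> a = \<zero>\<^bsub>A\<^esub>"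
      using a x by (intro indep) (auto simp: smult_assoc1)
    then have "c ?b = fraction A (self_module A) S \<zero>\<^bsub>A\<^esub> \<one>\<^bsub>A\<^esub>"
      unfolding c using a u one_in_S by (subst self.fraction_eq_iff) auto
    then show ?thesis by (simp add: F self.loc_zero)
  qed
  have "module_basis (loc_ring A S) (loc_module A M S) {?b}"
    unfolding module_basis_def
  proof (intro conjI ballI allI impI)
    show "{?b} \<subseteq> carrier (loc_module A M S)" using b by simp
  qed (rule span, assumption, elim conjE, rule independent)
  then show ?thesis
    unfolding free_module_def by blast
qed

section \<open>Monomials and restriction to a coordinate axis\<close>

lemma keys_sum_singles: "(\<Sum>m\<in>Poly_Mapping.keys f. Poly_Mapping.single m (Poly_Mapping.lookup f m)) = f"
  by (rule poly_mapping_eqI)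
    (auto simp: lookup_sum lookup_single when_def in_keys_iff sum.delta')

lemma lookup_single_mult:
  fixes f :: "('a::cancel_comm_monoid_add) \<Rightarrow>\<^sub>0 'b::comm_semiring_1"
  shows "Poly_Mapping.lookup (Poly_Mapping.single m c * f) (m + k) = c * Poly_Mapping.lookup f k"
proof -
  have "Poly_Mapping.single m c * f =
      (\<Sum>k\<in>Poly_Mapping.keys f. Poly_Mapping.single (m + k) (c * Poly_Mapping.lookup f k))"
    by (subst keys_sum_singles[of f, symmetric]) (simp add: sum_distrib_left mult_single)
  then show ?thesis
    by (simp add: lookup_sum lookup_single when_def in_keys_iff sum.delta')
qed

lemma keys_single_mult:
  fixes f :: "('a::cancel_comm_monoid_add) \<Rightarrow>\<^sub>0 'b::comm_semiring_1"
  shows "Poly_Mapping.keys (Poly_Mapping.single m c * f) \<subseteq> (+) m ` Poly_Mapping.keys f"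
  using keys_mult[of "Poly_Mapping.single m c" f] by (auto split: if_splits)

lemma single_mult_cancel:
  fixes f g :: "('a::cancel_comm_monoid_add) \<Rightarrow>\<^sub>0 'b::comm_semiring_1"
  assumes "Poly_Mapping.single m 1 * f = Poly_Mapping.single m 1 * g"
  shows "f = g"
proof (rule poly_mapping_eqI)
  fix k
  show "Poly_Mapping.lookup f k = Poly_Mapping.lookup g k"
    using arg_cong[OF assms, of "\<lambda>h. Poly_Mapping.lookup h (m + k)"] by (simp add: lookup_single_mult)
qed

lemma Var_power: "Var j ^ k = Poly_Mapping.single (Poly_Mapping.single j k) 1"
  by (induction k) (auto simp: Var_def mult_single single_add[symmetric])

lemma prod_single:
  "(\<Prod>j\<in>J. Poly_Mapping.single (f j) (c j)) = Poly_Mapping.single (\<Sum>j\<in>J. f j) (\<Prod>j\<in>J. c j)"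
  for c :: "_ \<Rightarrow> 'k::comm_semiring_1"
  by (induction J rule: infinite_finite_induct) (auto simp: mult_single)

lemma sum_single_coords: "(\<Sum>j\<in>UNIV. Poly_Mapping.single j (Poly_Mapping.lookup m j)) = m"
  for m :: "'n::finite \<Rightarrow>\<^sub>0 nat"
  by (rule poly_mapping_eqI) (auto simp: lookup_sum lookup_single when_def sum.delta')

lemma single_power_mult_cancel:
  fixes f g :: "('a::cancel_comm_monoid_add) \<Rightarrow>\<^sub>0 'b::comm_semiring_1"
  assumes "Poly_Mapping.single m 1 ^ k * f = Poly_Mapping.single m 1 ^ k * g"
  shows "f = g"
  using assms
proof (induction k)
  case (Suc k)
  have "Poly_Mapping.single m 1 ^ k * f = Poly_Mapping.single m 1 ^ k * g"
    by (rule single_mult_cancel[of m]) (use Suc.prems in \<open>simp add: mult.assoc\<close>)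
  then show ?case by (rule Suc.IH)
qed simp

lemma Const_eq_0_iff [simp]: "Const c = 0 \<longleftrightarrow> c = 0"
  by (metis Const_def lookup_single_eq lookup_zero single_zero)

lemma lookup_hom_component:
  "Poly_Mapping.lookup (hom_component k f) m = (if mon_degree m = k then Poly_Mapping.lookup f m else 0)"
  by (auto simp: hom_component_def lookup_sum lookup_single when_def in_keys_iff sum.delta')

lemma mon_degree_eq_0_iff [simp]: "mon_degree m = 0 \<longleftrightarrow> m = 0"
  by (auto simp: mon_degree_def poly_mapping_eq_iff fun_eq_iff)

lemma hom_component_0: "hom_component 0 f = Const (Poly_Mapping.lookup f 0)"
  by (rule poly_mapping_eqI) (auto simp: lookup_hom_component Const_def lookup_single when_def)

text \<open>
  The value of the monomial with exponent \<open>m\<close> at the point \<open>a\<close>. For \<open>a\<close> the diagonal of a matrix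
  this is the weight of the monomial, that is, its eigenvalue under the matrix.
\<close>
definition mon_eval :: "('n::finite \<Rightarrow> 'k::comm_semiring_1) \<Rightarrow> ('n \<Rightarrow>\<^sub>0 nat) \<Rightarrow> 'k" where
  "mon_eval a m = (\<Prod>j\<in>UNIV. a j ^ Poly_Mapping.lookup m j)"

lemma mon_eval_zero [simp]: "mon_eval a 0 = 1"
  by (simp add: mon_eval_def)

lemma mon_eval_add: "mon_eval a (m + m') = mon_eval a m * mon_eval a m'"
  by (simp add: mon_eval_def lookup_add power_add prod.distrib)

lemma mon_eval_mult: "mon_eval (\<lambda>j. a j * b j) m = mon_eval a m * mon_eval b m"
  by (simp add: mon_eval_def power_mult_distrib prod.distrib)

lemma mon_eval_single [simp]: "mon_eval a (Poly_Mapping.single j k) = a j ^ k"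
proof -
  have "mon_eval a (Poly_Mapping.single j k) = (\<Prod>i\<in>UNIV. if i = j then a j ^ k else 1)"
    unfolding mon_eval_def by (intro prod.cong) (auto simp: lookup_single when_def)
  then show ?thesis by simp
qed

lemma mon_eval_power: "mon_eval (\<lambda>j. a j ^ k) m = mon_eval a m ^ k"
  by (simp add: mon_eval_def prod_power_distrib mult.commute flip: power_mult)

lemma lookup_Const_mult: "Poly_Mapping.lookup (Const c * f) m = c * Poly_Mapping.lookup f m"
  using lookup_single_mult[of 0 c f m] by (simp add: Const_def)

lemma lookup_poly_act_diag:
  "Poly_Mapping.lookup (poly_act (diag_matrix a) f) m = mon_eval a m * Poly_Mapping.lookup f m"
proof -
  have lin: "(\<Sum>i\<in>UNIV. Const (diag_matrix a $ i $ j) * Var i) = Poly_Mapping.single (Poly_Mapping.single j 1) (a j)" for j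
  proof -
    have "(\<Sum>i\<in>UNIV. Const (diag_matrix a $ i $ j) * Var i) =
        (\<Sum>i\<in>UNIV. if i = j then Poly_Mapping.single (Poly_Mapping.single j 1) (a j) else 0)"
      by (intro sum.cong) (auto simp: diag_matrix_def Const_def Var_def mult_single)
    then show ?thesis by simp
  qed
  have pow: "Poly_Mapping.single (Poly_Mapping.single j 1) (a j) ^ k =
      Poly_Mapping.single (Poly_Mapping.single j k) (a j ^ k)" for j k
    by (induction k) (auto simp: mult_single single_add[symmetric])
  have "poly_act (diag_matrix a) f =
    (\<Sum>m\<in>Poly_Mapping.keys f. Poly_Mapping.single m (mon_eval a m * Poly_Mapping.lookup f m))"
    unfolding poly_act_def lin pow prod_single sum_single_coords mon_eval_def[of a, symmetric]
    unfolding Const_def mult_single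
    by (simp add: mult.commute)
  then show ?thesis
    by (simp add: lookup_sum lookup_single when_def in_keys_iff sum.delta')
qed

text \<open>
  The restriction of \<open>f\<close> to the \<open>j\<close>-th coordinate axis: all other variables are set to \<open>0\<close>. Being a
  ring homomorphism to an integral domain, it has a prime kernel.
\<close>
definition axis_poly :: "'n \<Rightarrow> ('k::field, 'n) mpol \<Rightarrow> 'k poly" where
  "axis_poly j f = (\<Sum>m\<in>Poly_Mapping.keys f.
     if Poly_Mapping.keys m \<subseteq> {j} then Polynomial.monom (Poly_Mapping.lookup f m) (Poly_Mapping.lookup m j) else 0)"

lemma axis_poly_superset:
  assumes "finite T" "Poly_Mapping.keys f \<subseteq> T"
  shows "axis_poly j f = (\<Sum>m\<in>T.
     if Poly_Mapping.keys m \<subseteq> {j} then Polynomial.monom (Poly_Mapping.lookup f m) (Poly_Mapping.lookup m j) else 0)"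
  unfolding axis_poly_def
  by (rule sum.mono_neutral_left) (use assms in \<open>auto simp: in_keys_iff\<close>)

lemma axis_poly_add: "axis_poly j (f + g) = axis_poly j f + axis_poly j g"
proof -
  let ?T = "Poly_Mapping.keys f \<union> Poly_Mapping.keys g"
  have "finite ?T" "Poly_Mapping.keys (f + g) \<subseteq> ?T" by (simp_all add: keys_add)
  then show ?thesis
    by (subst (1 2 3) axis_poly_superset[where T = ?T])
      (auto simp: lookup_add Polynomial.add_monom sum.distrib[symmetric] intro!: sum.cong)
qed

lemma axis_poly_zero [simp]: "axis_poly j 0 = 0"
  by (simp add: axis_poly_def)

lemma axis_poly_sum: "axis_poly j (\<Sum>i\<in>I. f i) = (\<Sum>i\<in>I. axis_poly j (f i))"
  by (induction I rule: infinite_finite_induct) (auto simp: axis_poly_add)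

lemma axis_poly_single:
  "axis_poly j (Poly_Mapping.single m c) =
    (if Poly_Mapping.keys m \<subseteq> {j} then Polynomial.monom c (Poly_Mapping.lookup m j) else 0)"
  by (simp add: axis_poly_def)

lemma keys_add_nat: "Poly_Mapping.keys (m + m') = Poly_Mapping.keys m \<union> Poly_Mapping.keys m'"
  for m m' :: "'n \<Rightarrow>\<^sub>0 nat"
  by (auto simp: in_keys_iff lookup_add)

lemma axis_poly_mult:
  fixes f g :: "('k::field, 'n) mpol"
  shows "axis_poly j (f * g) = axis_poly j f * axis_poly j g"
proof -
  have single: "axis_poly j (Poly_Mapping.single m c * Poly_Mapping.single m' c') =
      axis_poly j (Poly_Mapping.single m c) * axis_poly j (Poly_Mapping.single m' c')"
    for m m' :: "'n \<Rightarrow>\<^sub>0 nat" and c c' :: 'k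
    by (simp add: mult_single axis_poly_single keys_add_nat lookup_add Polynomial.mult_monom)
  have "axis_poly j (f * g) = (\<Sum>m\<in>Poly_Mapping.keys f. \<Sum>m'\<in>Poly_Mapping.keys g.
      axis_poly j (Poly_Mapping.single m (Poly_Mapping.lookup f m) *
        Poly_Mapping.single m' (Poly_Mapping.lookup g m')))"
    by (subst (1) keys_sum_singles[of f, symmetric], subst (1) keys_sum_singles[of g, symmetric])
      (simp only: sum_product axis_poly_sum)
  also have "\<dots> = axis_poly j f * axis_poly j g"
    unfolding single sum_product[symmetric] axis_poly_sum[symmetric] keys_sum_singles ..
  finally show ?thesis .
qed

lemma keys_subset_singleton_iff: "Poly_Mapping.keys m \<subseteq> {j} \<longleftrightarrow> m = Poly_Mapping.single j (Poly_Mapping.lookup m j)"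
proof
  assume "Poly_Mapping.keys m \<subseteq> {j}"
  then show "m = Poly_Mapping.single j (Poly_Mapping.lookup m j)"
    by (intro poly_mapping_eqI) (auto simp: lookup_single when_def in_keys_iff)
next
  assume "m = Poly_Mapping.single j (Poly_Mapping.lookup m j)"
  then show "Poly_Mapping.keys m \<subseteq> {j}"
    by (metis keys_single empty_subsetI order_refl)
qed

lemma coeff_axis_poly: "Polynomial.coeff (axis_poly j f) k = Poly_Mapping.lookup f (Poly_Mapping.single j k)"
proof -
  have "Polynomial.coeff (axis_poly j f) k = (\<Sum>m\<in>Poly_Mapping.keys f.
      if m = Poly_Mapping.single j k then Poly_Mapping.lookup f m else 0)"
    unfolding axis_poly_def Polynomial.coeff_sum keys_subset_singleton_iff
  proof (rule sum.cong)
    fix m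
    show "Polynomial.coeff (if m = Poly_Mapping.single j (Poly_Mapping.lookup m j)
          then Polynomial.monom (Poly_Mapping.lookup f m) (Poly_Mapping.lookup m j) else 0) k =
        (if m = Poly_Mapping.single j k then Poly_Mapping.lookup f m else 0)"
      by (cases "m = Poly_Mapping.single j k") auto
  qed simp
  then show ?thesis by (simp add: in_keys_iff)
qed

lemma axis_poly_single_axis [simp]: "axis_poly j (Poly_Mapping.single (Poly_Mapping.single j k) c) = Polynomial.monom c k"
  by (simp add: axis_poly_single)

section \<open>Diagonal matrices\<close>

lemma diag_matrix_nth [simp]: "diag_matrix a $ i $ j = (if i = j then a j else 0)"
  by (simp add: diag_matrix_def)

lemma diag_matrix_mult: "diag_matrix a ** diag_matrix b = diag_matrix (\<lambda>j. a j * b j)"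
  for a b :: "'n::finite \<Rightarrow> 'k::field"
proof -
  have "(\<Sum>k\<in>UNIV. diag_matrix a $ i $ k * diag_matrix b $ k $ j) =
      diag_matrix (\<lambda>j. a j * b j) $ i $ j" for i j
  proof -
    have "(\<Sum>k\<in>UNIV. diag_matrix a $ i $ k * diag_matrix b $ k $ j) =
        (\<Sum>k\<in>UNIV. if k = i then a i * diag_matrix b $ i $ j else 0)"
      by (intro sum.cong) auto
    then show ?thesis by simp
  qed
  then show ?thesis by (simp add: vec_eq_iff matrix_matrix_mult_def)
qed

lemma diag_matrix_one: "diag_matrix (\<lambda>_. 1) = mat 1"
  by (simp add: vec_eq_iff mat_def)

lemma GL_group: "group (GL :: ('k::field^'n::finite^'n) monoid)"
proof (rule groupI)
  fix A :: "'k^'n^'n" assume "A \<in> carrier GL"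
  then obtain B where B: "A ** B = mat 1" "B ** A = mat 1" by (auto simp: GL_def invertible_def)
  then show "\<exists>B\<in>carrier GL. B \<otimes>\<^bsub>GL\<^esub> A = \<one>\<^bsub>GL\<^esub>"
    by (intro bexI[of _ B]) (auto simp: GL_def invertible_def)
next
  show "\<one>\<^bsub>GL\<^esub> \<in> carrier (GL :: ('k^'n^'n) monoid)"
    by (auto simp: GL_def invertible_def)
qed (simp_all add: GL_def invertible_mult matrix_mul_assoc)

lemma diag_matrix_GL:
  fixes a :: "'n::finite \<Rightarrow> 'k::field"
  assumes "\<And>j. a j \<noteq> 0"
  shows "diag_matrix a \<in> carrier GL"
    and "inv\<^bsub>GL\<^esub> (diag_matrix a) = diag_matrix (\<lambda>j. inverse (a j))"
proof -
  have i: "diag_matrix a ** diag_matrix (\<lambda>j. inverse (a j)) = mat 1"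
       "diag_matrix (\<lambda>j. inverse (a j)) ** diag_matrix a = mat 1"
    using assms by (simp_all add: diag_matrix_mult diag_matrix_one)
  then show g: "diag_matrix a \<in> carrier GL"
    by (auto simp: GL_def invertible_def)
  have "diag_matrix (\<lambda>j. inverse (a j)) \<in> carrier GL"
    using i by (auto simp: GL_def invertible_def)
  with g i show "inv\<^bsub>GL\<^esub> (diag_matrix a) = diag_matrix (\<lambda>j. inverse (a j))"
    by (intro group.inv_equality[OF GL_group]) (auto simp: GL_def)
qed

lemma diag_matrix_GL_power:
  "diag_matrix a [^]\<^bsub>GL\<^esub> (k::nat) = diag_matrix (\<lambda>j. a j ^ k)"
  for a :: "'n::finite \<Rightarrow> 'k::field"
  by (induction k)
    (simp_all add: nat_pow_def GL_def diag_matrix_one diag_matrix_mult mult.commute)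

text \<open>The fixed space is the coordinate hyperplane on which the \<open>i\<close>-th coordinate vanishes.\<close>
lemma pseudo_reflection_diag_matrix:
  fixes a :: "'n::finite \<Rightarrow> 'k::field"
  assumes a: "\<And>k. k \<noteq> i \<Longrightarrow> a k = 1" "a i \<noteq> 1" and N: "a i ^ N = 1" "N > 0"
  shows "pseudo_reflection (diag_matrix a)"
proof -
  have "a j \<noteq> 0" for j using a N by (cases "j = i") (auto simp: power_0_left)
  then have "diag_matrix a \<in> carrier GL" by (rule diag_matrix_GL)
  moreover have "a j ^ N = 1" for j using a N by (cases "j = i") auto
  then have "diag_matrix a [^]\<^bsub>GL\<^esub> N = \<one>\<^bsub>GL\<^esub>"
    by (simp add: diag_matrix_GL_power diag_matrix_one) (simp add: GL_def)
  moreover have "{v. diag_matrix a *v v = v} = {v. \<forall>k. k \<notin> UNIV - {i} \<longrightarrow> v $ k = 0}"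
  proof -
    have "(diag_matrix a *v v) $ k = a k * v $ k" for v k
    proof -
      have "(diag_matrix a *v v) $ k = (\<Sum>j\<in>UNIV. if j = k then a k * v $ k else 0)"
        unfolding matrix_vector_mult_def vec_lambda_beta by (intro sum.cong) auto
      then show ?thesis by simp
    qed
    then have "diag_matrix a *v v = v \<longleftrightarrow> (\<forall>k. a k * v $ k = v $ k)" for v
      by (simp add: vec_eq_iff)
    also have "(\<forall>k. a k * v $ k = v $ k) \<longleftrightarrow> v $ i = 0" for v
      using a by (metis mult_cancel_right1 mult.left_neutral mult_zero_right)
    finally show ?thesis by auto
  qed
  then have "vec.dim {v. diag_matrix a *v v = v} = CARD('n) - 1"
    by (simp only: dim_substandard_cart) (simp add: card_Diff_singleton)
  ultimately show ?thesis
    using N(2) unfolding pseudo_reflection_def by blast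
qed

section \<open>Semi-invariants of a finite diagonal group\<close>

definition semi_invariant_exponents :: "('k::field^'n::finite^'n) set \<Rightarrow> ('k^'n^'n \<Rightarrow> 'k) \<Rightarrow> ('n \<Rightarrow>\<^sub>0 nat) set" where
  "semi_invariant_exponents G \<psi> = {m. \<forall>A\<in>G. mon_eval (\<lambda>j. A $ j $ j) m = \<psi> A}"

locale diagonal_group =
  fixes G :: "('k::field^'n::finite^'n) set" and N :: nat
  assumes finite_G: "finite G"
    and one_mem: "mat 1 \<in> G"
    and mult_mem: "\<lbrakk>A \<in> G; B \<in> G\<rbrakk> \<Longrightarrow> A ** B \<in> G"
    and diagonal: "A \<in> G \<Longrightarrow> A = diag_matrix (\<lambda>j. A $ j $ j)"
    and entry_power: "A \<in> G \<Longrightarrow> (A $ j $ j) ^ N = 1"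
    and N_pos: "0 < N"
begin

abbreviation wt :: "'k^'n^'n \<Rightarrow> ('n \<Rightarrow>\<^sub>0 nat) \<Rightarrow> 'k" where
  "wt A \<equiv> mon_eval (\<lambda>j. A $ j $ j)"

lemma entry_nonzero: "A \<in> G \<Longrightarrow> A $ j $ j \<noteq> 0"
  using entry_power[of A j] N_pos by (metis power_0_left less_numeral_extra(3) zero_neq_one)

lemma diagonal_mult: "\<lbrakk>A \<in> G; B \<in> G\<rbrakk> \<Longrightarrow> A ** B = diag_matrix (\<lambda>j. A $ j $ j * B $ j $ j)"
  by (metis diagonal diag_matrix_mult)

lemma wt_mult: "\<lbrakk>A \<in> G; B \<in> G\<rbrakk> \<Longrightarrow> wt (A ** B) m = wt A m * wt B m"
  by (simp add: diagonal_mult mon_eval_mult)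

lemma wt_power: "A \<in> G \<Longrightarrow> wt A m ^ N = 1"
  using entry_power by (simp add: mon_eval_power[symmetric]) (simp add: mon_eval_def)

text \<open>
  A diagonal matrix acts on coefficients one by one, so \<open>f\<close> is semi-invariant exactly if each of
  its monomials is.
\<close>
lemma semi_invariants_carrier:
  "f \<in> carrier (semi_invariants G \<psi>) \<longleftrightarrow> Poly_Mapping.keys f \<subseteq> semi_invariant_exponents G \<psi>"
proof -
  have "poly_act A f = Const (\<psi> A) * f \<longleftrightarrow> (\<forall>m\<in>Poly_Mapping.keys f. wt A m = \<psi> A)" if "A \<in> G" for A
  proof -
    have "Poly_Mapping.lookup (poly_act A f) m = wt A m * Poly_Mapping.lookup f m" for m
      using lookup_poly_act_diag[of "\<lambda>j. A $ j $ j" f m] diagonal[OF that] by simp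
    then show ?thesis
      by (auto simp: poly_mapping_eq_iff fun_eq_iff lookup_Const_mult in_keys_iff)
  qed
  then show ?thesis by (auto simp: semi_invariants_def semi_invariant_exponents_def)
qed

lemma invariant_ring_carrier: "carrier (invariant_ring G) = carrier (semi_invariants G (\<lambda>_. 1))"
  by (simp add: invariant_ring_def semi_invariants_def Const_def)

lemma invariant_ring_carrier_iff:
  "f \<in> carrier (invariant_ring G) \<longleftrightarrow> Poly_Mapping.keys f \<subseteq> semi_invariant_exponents G (\<lambda>_. 1)"
  by (simp add: invariant_ring_carrier semi_invariants_carrier)

lemma semi_invariants_mult:
  assumes "f \<in> carrier (semi_invariants G \<psi>)" "g \<in> carrier (semi_invariants G \<theta>)"
    and "\<And>A. A \<in> G \<Longrightarrow> \<psi> A * \<theta> A = \<omega> A"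
  shows "f * g \<in> carrier (semi_invariants G \<omega>)"
proof -
  have "Poly_Mapping.keys (f * g) \<subseteq> semi_invariant_exponents G \<omega>"
    using keys_mult[of f g] assms
    by (fastforce simp: semi_invariants_carrier semi_invariant_exponents_def mon_eval_add)
  then show ?thesis by (simp add: semi_invariants_carrier)
qed

lemma semi_invariants_power:
  assumes "f \<in> carrier (semi_invariants G \<psi>)"
  shows "f ^ k \<in> carrier (semi_invariants G (\<lambda>A. \<psi> A ^ k))"
proof (induction k)
  case 0
  show ?case by (auto simp: semi_invariants_carrier semi_invariant_exponents_def)
next
  case (Suc k)
  show ?case
    unfolding power_Suc by (rule semi_invariants_mult[OF assms Suc]) simp
qed

lemma monomial_mem: "m \<in> semi_invariant_exponents G \<psi> \<Longrightarrow> Poly_Mapping.single m c \<in> carrier (semi_invariants G \<psi>)"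
  by (simp add: semi_invariants_carrier)

lemma monomial_power_invariant: "Poly_Mapping.single m c ^ N \<in> carrier (invariant_ring G)"
proof -
  have "Poly_Mapping.single m c \<in> carrier (semi_invariants G (\<lambda>A. wt A m))"
    by (intro monomial_mem) (simp add: semi_invariant_exponents_def)
  from semi_invariants_power[OF this, of N] show ?thesis
    by (simp add: invariant_ring_carrier semi_invariants_carrier semi_invariant_exponents_def wt_power)
qed

lemma Const_mem: "Const c \<in> carrier (invariant_ring G)"
  by (simp add: invariant_ring_carrier_iff Const_def semi_invariant_exponents_def)

lemma Var_power_mem_iff: "Var j ^ u \<in> carrier (semi_invariants G \<psi>) \<longleftrightarrow> (\<forall>A\<in>G. (A $ j $ j) ^ u = \<psi> A)"
  by (simp add: Var_power semi_invariants_carrier semi_invariant_exponents_def)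

lemma Var_power_N_mem: "Var j ^ N \<in> carrier (invariant_ring G)"
  by (simp add: invariant_ring_carrier Var_power_mem_iff entry_power)

lemma invariant_ring_simps [simp]:
  "mult (invariant_ring G) = (*)" "one (invariant_ring G) = 1"
  "zero (invariant_ring G) = 0" "add (invariant_ring G) = (+)"
  by (simp_all add: invariant_ring_def)

lemma semi_invariants_simps [simp]:
  "zero (semi_invariants G \<psi>) = 0" "add (semi_invariants G \<psi>) = (+)"
  "smult (semi_invariants G \<psi>) = (*)"
  by (simp_all add: semi_invariants_def)

lemma semi_invariants_zero: "0 \<in> carrier (semi_invariants G \<psi>)"
  by (simp add: semi_invariants_carrier)

lemma semi_invariants_add:
  "\<lbrakk>f \<in> carrier (semi_invariants G \<psi>); g \<in> carrier (semi_invariants G \<psi>)\<rbrakk> \<Longrightarrow>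
    f + g \<in> carrier (semi_invariants G \<psi>)"
  using keys_add[of f g] by (auto simp: semi_invariants_carrier)

lemma semi_invariants_uminus:
  "f \<in> carrier (semi_invariants G \<psi>) \<Longrightarrow> - f \<in> carrier (semi_invariants G \<psi>)"
  by (auto simp: semi_invariants_carrier in_keys_iff subset_iff)

lemma semi_invariants_abelian_group: "abelian_group (semi_invariants G \<psi>)"
proof (rule abelian_groupI)
  fix f assume "f \<in> carrier (semi_invariants G \<psi>)"
  then show "\<exists>g\<in>carrier (semi_invariants G \<psi>). g \<oplus>\<^bsub>semi_invariants G \<psi>\<^esub> f = \<zero>\<^bsub>semi_invariants G \<psi>\<^esub>"
    by (intro bexI[of _ "- f"]) (auto intro: semi_invariants_uminus)
qed (auto intro: semi_invariants_add semi_invariants_zero simp: add.assoc add.commute)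

lemma invariant_ring_cring: "cring (invariant_ring G)"
proof (rule cringI)
  show "abelian_group (invariant_ring G)"
  proof (rule abelian_groupI)
    fix f assume "f \<in> carrier (invariant_ring G)"
    then show "\<exists>g\<in>carrier (invariant_ring G). g \<oplus>\<^bsub>invariant_ring G\<^esub> f = \<zero>\<^bsub>invariant_ring G\<^esub>"
      by (intro bexI[of _ "- f"]) (auto simp: invariant_ring_carrier intro: semi_invariants_uminus)
  qed (auto intro: semi_invariants_add semi_invariants_zero
      simp: invariant_ring_carrier add.assoc add.commute)
  show "comm_monoid (invariant_ring G)"
  proof (rule comm_monoidI)
    show "\<one>\<^bsub>invariant_ring G\<^esub> \<in> carrier (invariant_ring G)"
      using Const_mem[of 1] by (simp add: Const_def)
  qed (auto intro: semi_invariants_mult simp: invariant_ring_carrier mult.assoc mult.commute)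
qed (simp add: distrib_right)

lemma semi_invariants_module: "module (invariant_ring G) (semi_invariants G \<psi>)"
proof (rule moduleI)
  fix a x assume "a \<in> carrier (invariant_ring G)" "x \<in> carrier (semi_invariants G \<psi>)"
  then show "a \<odot>\<^bsub>semi_invariants G \<psi>\<^esub> x \<in> carrier (semi_invariants G \<psi>)"
    by (auto intro: semi_invariants_mult simp: invariant_ring_carrier)
qed (simp_all add: invariant_ring_cring semi_invariants_abelian_group algebra_simps)

lemma semi_invariants_induct [consumes 1, case_names zero add single]:
  assumes f: "f \<in> carrier (semi_invariants G \<psi>)"
    and zero: "P 0"
    and add: "\<And>x y. \<lbrakk>x \<in> carrier (semi_invariants G \<psi>); y \<in> carrier (semi_invariants G \<psi>); P x; P y\<rbrakk> \<Longrightarrow> P (x + y)"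
    and single: "\<And>m c. m \<in> semi_invariant_exponents G \<psi> \<Longrightarrow> P (Poly_Mapping.single m c)"
  shows "P f"
proof -
  let ?s = "\<lambda>T. \<Sum>m\<in>T. Poly_Mapping.single m (Poly_Mapping.lookup f m)"
  have "P (?s T) \<and> ?s T \<in> carrier (semi_invariants G \<psi>)"
    if "finite T" "T \<subseteq> semi_invariant_exponents G \<psi>" for T
    using that
    by (induction T) (auto simp: zero semi_invariants_zero intro!: add single monomial_mem semi_invariants_add)
  from this[of "Poly_Mapping.keys f"] f show ?thesis
    by (simp add: keys_sum_singles semi_invariants_carrier)
qed

end

section \<open>Graded primes of the invariant ring\<close>

context diagonal_group
begin

text \<open>
  If \<open>p\<close> contained every \<open>X_j^N\<close>, it would contain \<open>x^N\<close>, and hence \<open>x\<close>, for every invariant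
  monomial \<open>x \<noteq> 1\<close>. These monomials span the graded maximal ideal. Conversely, a graded prime
  lies in the graded maximal ideal, for otherwise it would contain a nonzero constant.
\<close>
lemma graded_prime_misses_Var_power:
  assumes p: "p \<in> graded_Spec (invariant_ring G)" and ne: "p \<noteq> graded_max_ideal (invariant_ring G)"
  obtains j where "Var j ^ N \<notin> p"
proof (rule ccontr)
  assume *: "\<not> thesis"
  then have Var: "Var j ^ N \<in> p" for j using that by blast
  interpret p: primeideal p "invariant_ring G"
    using p by (simp add: graded_Spec_def)
  note p_zero = additive_subgroup.zero_closed[OF p.is_additive_subgroup, simplified]
  note p_add = additive_subgroup.a_closed[OF p.is_additive_subgroup, simplified]
  have one: "1 \<notin> p" using p.one_imp_carrier p.I_notcarr by auto
  have "p \<subseteq> graded_max_ideal (invariant_ring G)"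
  proof
    fix f assume f: "f \<in> p"
    define c where "c = Poly_Mapping.lookup f 0"
    have "hom_component 0 f \<in> p" using p f by (auto simp: graded_Spec_def)
    then have c: "Const c \<in> p" by (simp add: c_def hom_component_0)
    have "c = 0"
    proof (rule ccontr)
      assume "c \<noteq> 0"
      then have "Const (inverse c) * Const c = (1 :: ('k, 'n) mpol)" by (simp add: Const_def mult_single)
      moreover have "Const (inverse c) * Const c \<in> p"
        using p.I_l_closed[OF c Const_mem, of "inverse c"] by simp
      ultimately show False using one by simp
    qed
    then show "f \<in> graded_max_ideal (invariant_ring G)"
      using f p.a_subset by (auto simp: graded_max_ideal_def hom_component_0 c_def)
  qed
  moreover have "graded_max_ideal (invariant_ring G) \<subseteq> p"
  proof
    fix f assume f: "f \<in> graded_max_ideal (invariant_ring G)"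
    then have fc: "f \<in> carrier (invariant_ring G)" and f0: "Poly_Mapping.lookup f 0 = 0"
      by (auto simp: graded_max_ideal_def hom_component_0)
    have mono: "Poly_Mapping.single m c \<in> p" if m: "m \<in> semi_invariant_exponents G (\<lambda>_. 1)" "m \<noteq> 0" for m c
    proof -
      obtain j where j: "Poly_Mapping.lookup m j \<noteq> 0"
        using m(2) by (metis poly_mapping_eqI lookup_zero)
      \<comment> \<open>Write the monomial as \<open>X_j * r\<close>. Its \<open>N\<close>-th power is \<open>X_j^N\<close> times the invariant \<open>r^N\<close>.\<close>
      define r where "r = m - Poly_Mapping.single j 1"
      have "m = Poly_Mapping.single j 1 + r"
        using j by (intro poly_mapping_eqI) (auto simp: r_def lookup_add lookup_minus lookup_single when_def)
      then have "Poly_Mapping.single m (1::'k) = Var j * Poly_Mapping.single r 1"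
        by (simp add: Var_def mult_single)
      then have "Poly_Mapping.single m (1::'k) ^ N = Poly_Mapping.single r 1 ^ N * Var j ^ N"
        by (simp add: power_mult_distrib mult.commute)
      also have "\<dots> \<in> p"
        using p.I_l_closed[OF Var monomial_power_invariant] by simp
      finally have pow: "Poly_Mapping.single m (1::'k) ^ N \<in> p" .
      have X: "Poly_Mapping.single m (1::'k) \<in> carrier (invariant_ring G)"
        using m by (simp add: invariant_ring_carrier monomial_mem)
      have "Poly_Mapping.single m (1::'k) \<in> p" if "Poly_Mapping.single m (1::'k) ^ k \<in> p" for k
        using that
      proof (induction k)
        case 0
        then show ?case using one by simp
      next
        case (Suc k)
        have "Poly_Mapping.single m (1::'k) ^ k \<in> carrier (invariant_ring G)"
          using semi_invariants_power[of "Poly_Mapping.single m 1" "\<lambda>_. 1" k] X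
          by (simp add: invariant_ring_carrier)
        then show ?case
          using Suc p.I_prime[OF X, of "Poly_Mapping.single m 1 ^ k"] by auto
      qed
      then have "Poly_Mapping.single m (1::'k) \<in> p" using pow by blast
      from p.I_l_closed[OF this Const_mem, of c] show ?thesis
        by (simp add: Const_def mult_single)
    qed
    have "(\<Sum>m\<in>T. Poly_Mapping.single m (Poly_Mapping.lookup f m)) \<in> p"
      if "finite T" "T \<subseteq> Poly_Mapping.keys f" for T
      using that
    proof (induction T)
      case empty
      then show ?case using p_zero by simp
    next
      case (insert m T)
      then have "m \<in> semi_invariant_exponents G (\<lambda>_. 1)" "m \<noteq> 0"
        using fc f0 by (auto simp: invariant_ring_carrier_iff in_keys_iff)
      then show ?case
        using insert p_add[OF mono] by simp
    qed
    from this[of "Poly_Mapping.keys f"] show "f \<in> p" by (simp add: keys_sum_singles)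
  qed
  ultimately show False using ne by blast
qed

definition axis_prime :: "'n \<Rightarrow> ('k, 'n) mpol set" where
  "axis_prime j = {f \<in> carrier (invariant_ring G). axis_poly j f = 0}"

lemma axis_prime_primeideal: "primeideal (axis_prime j) (invariant_ring G)"
proof -
  interpret R: cring "invariant_ring G" by (rule invariant_ring_cring)
  have minus: "axis_poly j (- f) = - axis_poly j f" for f
    using axis_poly_add[of j f "- f"] by (simp add: eq_neg_iff_add_eq_0 add.commute)
  have a_inv: "\<ominus>\<^bsub>invariant_ring G\<^esub> f = - f" if "f \<in> carrier (invariant_ring G)" for f
    using that by (intro R.minus_equality) (auto simp: invariant_ring_carrier intro: semi_invariants_uminus)
  show ?thesis
  proof (rule primeidealI)
    show "ideal (axis_prime j) (invariant_ring G)"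
    proof (rule idealI)
      show "subgroup (axis_prime j) (add_monoid (invariant_ring G))"
      proof (rule R.add.subgroupI)
        show "axis_prime j \<noteq> {}" using R.zero_closed by (auto simp: axis_prime_def)
      next
        fix f assume "f \<in> axis_prime j"
        then show "\<ominus>\<^bsub>invariant_ring G\<^esub> f \<in> axis_prime j"
          using R.a_inv_closed[of f] by (auto simp: axis_prime_def a_inv minus)
      next
        fix f g assume "f \<in> axis_prime j" "g \<in> axis_prime j"
        then show "f \<oplus>\<^bsub>invariant_ring G\<^esub> g \<in> axis_prime j"
          using R.a_closed[of f g] by (auto simp: axis_prime_def axis_poly_add)
      qed (auto simp: axis_prime_def)
    next
      fix f g assume "f \<in> axis_prime j" "g \<in> carrier (invariant_ring G)"
      then show "g \<otimes>\<^bsub>invariant_ring G\<^esub> f \<in> axis_prime j" "f \<otimes>\<^bsub>invariant_ring G\<^esub> g \<in> axis_prime j"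
        using R.m_closed[of f g] R.m_closed[of g f] by (auto simp: axis_prime_def axis_poly_mult)
    qed (rule R.ring_axioms)
    have "axis_poly j (1 :: ('k, 'n) mpol) = 1"
      using axis_poly_single_axis[of j 0 1] by (simp add: one_pCons monom_0)
    then have "1 \<notin> axis_prime j" by (simp add: axis_prime_def)
    then show "carrier (invariant_ring G) \<noteq> axis_prime j"
      using R.one_closed by auto
  qed (auto simp: axis_prime_def axis_poly_mult invariant_ring_cring)
qed

lemma axis_prime_graded: "axis_prime j \<in> graded_Spec (invariant_ring G)"
proof -
  have "hom_component k f \<in> axis_prime j" if f: "f \<in> axis_prime j" for f k
  proof -
    have "Poly_Mapping.keys (hom_component k f) \<subseteq> Poly_Mapping.keys f"
      by (auto simp: in_keys_iff lookup_hom_component split: if_splits)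
    moreover have "axis_poly j (hom_component k f) = 0"
    proof (rule poly_eqI)
      fix i
      show "Polynomial.coeff (axis_poly j (hom_component k f)) i = Polynomial.coeff 0 i"
        using f coeff_axis_poly[of j f i] by (simp add: axis_prime_def coeff_axis_poly lookup_hom_component)
    qed
    ultimately show ?thesis
      using f by (auto simp: axis_prime_def invariant_ring_carrier_iff)
  qed
  then show ?thesis
    using axis_prime_primeideal by (simp add: graded_Spec_def)
qed

lemma axis_prime_not_max: "axis_prime j \<noteq> graded_max_ideal (invariant_ring G)"
proof -
  have "Var j ^ N \<in> graded_max_ideal (invariant_ring G)"
    using N_pos Var_power_N_mem
    by (simp add: graded_max_ideal_def hom_component_0 Var_power lookup_single when_def)
      (metis lookup_single_eq lookup_zero less_numeral_extra(3))
  moreover have "Var j ^ N \<notin> axis_prime j"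
    by (simp add: axis_prime_def Var_power monom_eq_0_iff)
  ultimately show ?thesis by blast
qed

end

section \<open>Semi-invariants with large trace are locally free\<close>

locale diagonal_character = diagonal_group G N
  for G :: "('k::field^'n::finite^'n) set" and N :: nat +
  fixes \<phi> :: "'k^'n^'n \<Rightarrow> 'k"
  assumes char_mult: "\<lbrakk>A \<in> G; B \<in> G\<rbrakk> \<Longrightarrow> \<phi> (A ** B) = \<phi> A * \<phi> B"
    and char_nonzero: "A \<in> G \<Longrightarrow> \<phi> A \<noteq> 0"
begin

abbreviation R where "R \<equiv> invariant_ring G"
abbreviation M where "M \<equiv> semi_invariants G \<phi>"
abbreviation E where "E \<equiv> semi_invariant_exponents G \<phi>"
abbreviation xmon :: "('n \<Rightarrow>\<^sub>0 nat) \<Rightarrow> ('k, 'n) mpol" where "xmon m \<equiv> Poly_Mapping.single m 1"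

lemma xmon_mem: "m \<in> E \<Longrightarrow> xmon m \<in> carrier M"
  by (rule monomial_mem)

text \<open>
  This lemma and the next express that \<open>R\<^sup>\<phi>\<close> has rank one: a monomial \<open>x\<close> and an arbitrary \<open>y\<close> in
  \<open>R\<^sup>\<phi>\<close> satisfy the relation \<open>(x^(N - 1) * y) * x = x^N * y\<close> with coefficients in \<open>R\<^sup>G\<close>, since
  \<open>\<phi>^N = 1\<close>.
\<close>
lemma cross_multiplier_mem:
  assumes m: "m \<in> E" and y: "y \<in> carrier M"
  shows "xmon m ^ (N - 1) * y \<in> carrier R"
  unfolding invariant_ring_carrier
proof (rule semi_invariants_mult[OF semi_invariants_power[OF xmon_mem[OF m]] y])
  fix A assume "A \<in> G"
  then have "\<phi> A ^ N = 1"
    using m wt_power[of A m] by (simp add: semi_invariant_exponents_def)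
  then show "\<phi> A ^ (N - 1) * \<phi> A = 1"
    using N_pos by (simp flip: power_Suc2)
qed

lemma cross_relation: "(xmon m ^ (N - 1) * y) * xmon m = xmon m ^ N * y"
  using N_pos by (cases N) (simp_all add: algebra_simps)

text \<open>The homomorphism with \<open>X_j^N\<close> in its image is multiplication by \<open>X_j^(N - u)\<close>.\<close>
lemma trace_contains_powers:
  assumes "\<And>j. \<exists>u. 0 < u \<and> u \<le> N \<and> Var j ^ u \<in> carrier M"
  shows "Idl\<^bsub>R\<^esub> (range (\<lambda>j. Var j ^ N)) \<subseteq> module_trace R M"
proof -
  interpret R: cring R by (rule invariant_ring_cring)
  have "Var j ^ N \<in> module_trace R M" for j
  proof -
    obtain u where u: "0 < u" "u \<le> N" "Var j ^ u \<in> carrier M" using assms by blast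
    define f :: "('k, 'n) mpol \<Rightarrow> ('k, 'n) mpol" where "f y = Var j ^ (N - u) * y" for y
    have "f y \<in> carrier R" if y: "y \<in> carrier M" for y
      unfolding f_def invariant_ring_carrier
    proof (rule semi_invariants_mult[OF _ y])
      show "Var j ^ (N - u) \<in> carrier (semi_invariants G (\<lambda>A. (A $ j $ j) ^ (N - u)))"
        by (simp add: Var_power_mem_iff)
      fix A assume A: "A \<in> G"
      then have "\<phi> A = (A $ j $ j) ^ u" using u by (simp add: Var_power_mem_iff)
      then show "(A $ j $ j) ^ (N - u) * \<phi> A = 1"
        using u entry_power[OF A] by (simp flip: power_add)
    qed
    then have "f \<in> mod_homs R M (self_module R)"
      by (auto simp: mod_homs_def f_def algebra_simps)
    from hom_value_in_trace[OF semi_invariants_module this u(3)] show ?thesis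
      using u by (simp add: f_def flip: power_add)
  qed
  then show ?thesis
    by (intro R.genideal_minimal module_trace_ideal semi_invariants_module) auto
qed

text \<open>
  A homomorphism \<open>f\<close> whose image is not contained in \<open>p\<close> already takes a value outside \<open>p\<close> at a
  monomial \<open>x\<close>, because \<open>R\<^sup>\<phi>\<close> is spanned by monomials and \<open>p\<close> is closed under sums. Applying \<open>f\<close> to the
  rank one relation and cancelling \<open>x^(N - 1)\<close> gives \<open>f x * y = f y * x\<close>. As \<open>f x\<close> becomes a unit,
  \<open>x\<close> generates the localized module.
\<close>
lemma free_at_prime_if_trace:
  assumes p: "primeideal p R" and trace: "\<not> module_trace R M \<subseteq> p"
  shows "free_module (loc_ring R (carrier R - p)) (loc_module R M (carrier R - p))"
proof -
  interpret p: primeideal p R by (rule p)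
  note p_zero = additive_subgroup.zero_closed[OF p.is_additive_subgroup, simplified]
  note p_add = additive_subgroup.a_closed[OF p.is_additive_subgroup, simplified]
  interpret localization R M "carrier R - p"
    by (rule localization_prime[OF semi_invariants_module p])
  obtain f x where f: "f \<in> mod_homs R M (self_module R)" and x: "x \<in> carrier M" "f x \<notin> p"
    using trace_subset_ideal[OF semi_invariants_module p.is_ideal] trace by blast
  note hom = mod_homsD[OF f, simplified]
  have "\<exists>m\<in>E. f (xmon m) \<notin> p"
  proof (rule ccontr)
    assume "\<not> ?thesis"
    then have *: "f (xmon m) \<in> p" if "m \<in> E" for m using that by blast
    have "f x \<in> p"
      using x(1)
    proof (induction rule: semi_invariants_induct)
      case zero
      then show ?case
        using mod_homs_zero[OF semi_invariants_module f] p_zero by simp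
    next
      case (add x y)
      then show ?case using hom(2) p_add by simp
    next
      case (single m c)
      have "Poly_Mapping.single m c = Const c * xmon m" by (simp add: Const_def mult_single)
      then have "f (Poly_Mapping.single m c) = Const c * f (xmon m)"
        using hom(3)[OF Const_mem xmon_mem[OF single]] by simp
      then show ?case
        using p.I_l_closed[OF *[OF single] Const_mem] by simp
    qed
    with x show False by blast
  qed
  then obtain m where m: "m \<in> E" "f (xmon m) \<notin> p" by blast
  have cross: "f (xmon m) * y = f y * xmon m" if y: "y \<in> carrier M" for y
  proof -
    have "xmon m ^ (N - 1) * (f (xmon m) * y) = (xmon m ^ (N - 1) * y) * f (xmon m)"
      by (simp add: algebra_simps)
    also have "\<dots> = f ((xmon m ^ (N - 1) * y) * xmon m)"
      using hom(3)[OF cross_multiplier_mem[OF m(1) y] xmon_mem[OF m(1)]] by simp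
    also have "\<dots> = xmon m ^ N * f y"
      unfolding cross_relation using hom(3)[OF monomial_power_invariant y, of m 1] by simp
    also have "\<dots> = xmon m ^ (N - 1) * (f y * xmon m)"
      using N_pos by (cases N) (simp_all add: algebra_simps)
    finally show ?thesis by (rule single_power_mult_cancel)
  qed
  show ?thesis
  proof (rule free_if_generator[OF xmon_mem[OF m(1)]])
    fix y assume y: "y \<in> carrier M"
    show "\<exists>s\<in>carrier R - p. \<exists>a\<in>carrier R. s \<odot>\<^bsub>M\<^esub> y = a \<odot>\<^bsub>M\<^esub> xmon m"
      using cross[OF y] m hom(1)[OF y] hom(1)[OF xmon_mem[OF m(1)]]
      by (intro bexI[of _ "f (xmon m)"] bexI[of _ "f y"]) auto
  next
    fix a assume "a \<odot>\<^bsub>M\<^esub> xmon m = \<zero>\<^bsub>M\<^esub>"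
    then have "xmon m * a = xmon m * 0" by (simp add: mult.commute)
    then show "a = \<zero>\<^bsub>R\<^esub>" using single_mult_cancel by fastforce
  qed
qed

section \<open>Characters as weights of monomials avoiding a variable\<close>

lemma char_one: "\<phi> (mat 1) = 1"
  using char_mult[OF one_mem one_mem] char_nonzero[OF one_mem] by simp

text \<open>
  An element that fixes all coordinates except possibly the \<open>i\<close>-th is the identity or a
  pseudo-reflection. So, without pseudo-reflections, the coordinates other than \<open>i\<close> tell each
  nontrivial element from the identity.
\<close>
lemma ex_separating_coordinate:
  fixes A :: "'k^'n^'n"
  assumes np: "\<forall>B\<in>G. \<not> pseudo_reflection B" and A: "A \<in> G" "A \<noteq> mat 1"
  shows "\<exists>k. k \<noteq> i \<and> A $ k $ k \<noteq> 1"
proof (rule ccontr)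
  assume "\<not> ?thesis"
  then have 1: "\<And>k. k \<noteq> i \<Longrightarrow> A $ k $ k = 1" by blast
  have "A $ i $ i \<noteq> 1"
  proof
    assume "A $ i $ i = 1"
    then have "A $ k $ k = 1" for k using 1 by (cases "k = i") auto
    then have "(\<lambda>k. A $ k $ k) = (\<lambda>_. 1)" by (intro ext)
    then have "diag_matrix (\<lambda>k. A $ k $ k) = mat 1" by (simp only: diag_matrix_one)
    then show False using diagonal[OF A(1)] A(2) by simp
  qed
  then have "pseudo_reflection (diag_matrix (\<lambda>k. A $ k $ k))"
    using 1 entry_power[OF A(1)] N_pos by (intro pseudo_reflection_diag_matrix) auto
  then show False using np A(1) diagonal[OF A(1)] by simp
qed

text \<open>
  The vanishing of the sum of a nontrivial character: translating the group by \<open>B\<close> multiplies the sum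
  by \<open>wt B m / \<phi> B \<noteq> 1\<close>.
\<close>
lemma sum_wt_over_char:
  assumes B: "B \<in> G" "wt B m \<noteq> \<phi> B"
  shows "(\<Sum>A\<in>G. wt A m / \<phi> A) = 0"
proof -
  have inj: "inj_on (\<lambda>A. B ** A) G"
  proof (rule inj_onI)
    fix A A' assume A: "A \<in> G" "A' \<in> G" and e: "B ** A = B ** A'"
    have "(\<lambda>j. A $ j $ j) = (\<lambda>j. A' $ j $ j)"
    proof
      fix j show "A $ j $ j = A' $ j $ j"
        using arg_cong[OF e, of "\<lambda>C. C $ j $ j"] entry_nonzero[OF B(1), of j] A
        by (simp add: diagonal_mult[OF B(1)])
    qed
    then show "A = A'" using diagonal[OF A(1)] diagonal[OF A(2)] by simp
  qed
  have "(\<lambda>A. B ** A) ` G = G"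
    using inj finite_G mult_mem[OF B(1)] by (intro endo_inj_surj) auto
  then have "(\<Sum>A\<in>G. wt A m / \<phi> A) = (\<Sum>A\<in>(\<lambda>A. B ** A) ` G. wt A m / \<phi> A)" by simp
  also have "\<dots> = (\<Sum>A\<in>G. wt (B ** A) m / \<phi> (B ** A))"
    using inj by (simp add: sum.reindex)
  also have "\<dots> = (\<Sum>A\<in>G. wt B m / \<phi> B * (wt A m / \<phi> A))"
    using B(1) by (intro sum.cong) (auto simp: wt_mult char_mult)
  also have "\<dots> = wt B m / \<phi> B * (\<Sum>A\<in>G. wt A m / \<phi> A)"
    by (simp add: sum_distrib_left)
  finally have "(wt B m / \<phi> B - 1) * (\<Sum>A\<in>G. wt A m / \<phi> A) = 0"
    by (simp add: algebra_simps)
  then show ?thesis using B char_nonzero[OF B(1)] by (auto simp: field_simps)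
qed

text \<open>
  Suppose that \<open>\<phi>\<close> is not the weight of any monomial without \<open>X_i\<close>. Then the functional
  \<open>h \<mapsto> (\<Sum>A\<in>G. h A / \<phi> A)\<close> vanishes on the weights of all these monomials, hence on all
  polynomial functions in the coordinates other than \<open>i\<close>. But those coordinates separate the
  identity from each other element, so a product of differences of coordinates is a
  polynomial function that vanishes on \<open>G\<close> except at the identity, and the functional
  does not vanish on it.
\<close>
lemma ex_exponent_avoiding:
  assumes np: "\<forall>B\<in>G. \<not> pseudo_reflection B"
  shows "\<exists>m\<in>E. Poly_Mapping.lookup m i = 0"
proof (rule ccontr)
  assume "\<not> ?thesis"
  then have noE: "\<exists>B\<in>G. wt B m \<noteq> \<phi> B" if "Poly_Mapping.lookup m i = 0" for m
    using that by (auto simp: semi_invariant_exponents_def)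
  obtain k where k: "\<And>A. \<lbrakk>A \<in> G; A \<noteq> mat 1\<rbrakk> \<Longrightarrow> k A \<noteq> i \<and> A $ k A $ k A \<noteq> 1"
    using ex_separating_coordinate[OF np, of _ i] by metis
  let ?d = "\<lambda>C A. A $ k C $ k C - C $ k C $ k C"
  \<comment> \<open>The extra factor \<open>wt A m\<close> makes the induction work: multiplying out one factor of the
    product yields two sums of the same form, one with \<open>m\<close> multiplied by a further variable.\<close>
  have vanish: "(\<Sum>A\<in>G. wt A m * (\<Prod>C\<in>H. ?d C A) / \<phi> A) = 0"
    if "finite H" "H \<subseteq> G - {mat 1}" "Poly_Mapping.lookup m i = 0" for H m
    using that
  proof (induction H arbitrary: m)
    case empty
    then show ?case using noE[of m] sum_wt_over_char by auto
  next
    case (insert C H)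
    let ?m = "m + Poly_Mapping.single (k C) 1"
    have C: "k C \<noteq> i" using k insert.prems by auto
    have "(\<Sum>A\<in>G. wt A m * (\<Prod>C\<in>insert C H. ?d C A) / \<phi> A) =
        (\<Sum>A\<in>G. wt A ?m * (\<Prod>C\<in>H. ?d C A) / \<phi> A -
          C $ k C $ k C * (wt A m * (\<Prod>C\<in>H. ?d C A) / \<phi> A))"
      using insert.hyps by (intro sum.cong) (auto simp: mon_eval_add algebra_simps diff_divide_distrib)
    also have "\<dots> = (\<Sum>A\<in>G. wt A ?m * (\<Prod>C\<in>H. ?d C A) / \<phi> A) -
          C $ k C $ k C * (\<Sum>A\<in>G. wt A m * (\<Prod>C\<in>H. ?d C A) / \<phi> A)"
      by (simp add: sum_subtractf sum_distrib_left)
    also have "\<dots> = 0"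
      using insert.prems insert.IH[of ?m] insert.IH[of m] C
      by (simp add: lookup_add lookup_single when_def)
    finally show ?case .
  qed
  let ?H = "G - {mat 1}"
  have "(\<Prod>C\<in>?H. ?d C A) = 0" if "A \<in> G" "A \<noteq> mat 1" for A
    using that finite_G by (intro prod_zero) auto
  then have "(\<Sum>A\<in>G. wt A 0 * (\<Prod>C\<in>?H. ?d C A) / \<phi> A) =
      (\<Sum>A\<in>{mat 1}. wt A 0 * (\<Prod>C\<in>?H. ?d C A) / \<phi> A)"
    using finite_G one_mem by (intro sum.mono_neutral_right) auto
  then have "(\<Prod>C\<in>?H. ?d C (mat 1)) = 0"
    using vanish[of ?H 0] finite_G by (simp add: char_one)
  then obtain C where "C \<in> ?H" "?d C (mat 1) = 0"
    using finite_G by (auto simp: prod_zero_iff)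
  then show False using k[of C] by (auto simp: mat_def)
qed

section \<open>Local freeness on the coordinate axes\<close>

text \<open>
  Let \<open>\<pi>\<close> be the coordinate function of a basis element of the localization at the axis prime \<open>p\<close>.
  If \<open>\<pi>\<close> took values in the maximal ideal at all monomials, it would do so everywhere, although it
  takes the value \<open>1\<close>. So \<open>\<pi> x = g / t\<close> with \<open>g \<notin> p\<close> for some monomial \<open>x\<close> with exponent \<open>m\<close>. The
  rank one relation gives \<open>q * y = c * x\<close> for each monomial \<open>y\<close>, with polynomials \<open>q \<notin> p\<close> and \<open>c\<close>.
  Since \<open>q\<close> contains a power of \<open>X_j\<close>, comparing coefficients shows that \<open>x\<close> divides \<open>y\<close> times that
  power.
\<close>
lemma ex_least_exponent_off_axis:
  assumes free: "free_module (loc_ring R (carrier R - axis_prime j)) (loc_module R M (carrier R - axis_prime j))"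
    and ne: "E \<noteq> {}"
  shows "\<exists>m\<in>E. \<forall>y\<in>E. \<forall>i. i \<noteq> j \<longrightarrow> Poly_Mapping.lookup m i \<le> Poly_Mapping.lookup y i"
proof -
  define p where "p = axis_prime j"
  define S where "S = carrier R - p"
  have prime: "primeideal p R" unfolding p_def by (rule axis_prime_primeideal)
  interpret p: primeideal p R by (rule prime)
  note p_zero = additive_subgroup.zero_closed[OF p.is_additive_subgroup, simplified]
  note p_add = additive_subgroup.a_closed[OF p.is_additive_subgroup, simplified]
  interpret localization R M S
    unfolding S_def by (rule localization_prime[OF semi_invariants_module prime])
  interpret self: localization R "self_module R" S
    by (rule localization_self)
  interpret L: module "loc_ring R S" "loc_module R M S"
    by (rule loc_module_module)
  let ?fr = "fraction R M S" and ?fs = "fraction R (self_module R) S"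
  have S_p: "q \<notin> p" if "q \<in> S" for q
    using that unfolding S_def by blast
  have axis: "axis_poly j q \<noteq> 0" if "q \<in> S" for q
    using that unfolding S_def p_def axis_prime_def by blast
  have mult1: "1 \<in> S" using one_in_S by simp
  obtain B where B: "module_basis (loc_ring R S) (loc_module R M S) B"
    using free unfolding free_module_def S_def p_def by blast
  obtain y0 where y0: "y0 \<in> E" using ne by blast
  have "B \<noteq> {}"
  proof
    assume "B = {}"
    then have "?fr (xmon y0) 1 = \<zero>\<^bsub>loc_module R M S\<^esub>"
      using B fraction_closed[OF xmon_mem[OF y0] mult1] by (auto simp: module_basis_def)
    then obtain u where u: "u \<in> S" "u * xmon y0 = 0"
      using xmon_mem[OF y0] mult1 semi_invariants_zero by (auto simp: loc_zero fraction_eq_iff)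
    then have "xmon y0 * u = xmon y0 * 0" by (simp add: mult.commute)
    then have "u = 0" by (rule single_mult_cancel)
    then show False using S_p[OF u(1)] p_zero by simp
  qed
  then obtain b where b: "b \<in> B" by blast
  then have "b \<in> carrier (loc_module R M S)" using B by (auto simp: module_basis_def)
  then obtain x s where x: "x \<in> carrier M" "s \<in> S" and b_eq: "b = ?fr x s"
    unfolding loc_carrier by blast
  obtain \<pi> where pi: "\<pi> \<in> mod_homs (loc_ring R S) (loc_module R M S) (self_module (loc_ring R S))"
    and pi_b: "\<pi> b = \<one>\<^bsub>loc_ring R S\<^esub>"
    using module_basis_coordinate[OF loc_module_module B b] by blast
  note hom = mod_homsD[OF pi, simplified]
  have pi_smult: "\<pi> (?fr (a * z) 1) = ?fs a 1 \<odot>\<^bsub>loc_module R (self_module R) S\<^esub> \<pi> (?fr z 1)"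
    if "a \<in> carrier R" "z \<in> carrier M" for a z
  proof -
    have "?fr (a * z) 1 = ?fs a 1 \<odot>\<^bsub>loc_module R M S\<^esub> ?fr z 1"
      using loc_smult[of a 1 z 1] that mult1 by simp
    then show ?thesis
      using hom(3)[of "?fs a 1" "?fr z 1"] that mult1 by simp
  qed
  have pi_frac: "\<exists>g\<in>carrier R. \<exists>t\<in>S. \<pi> (?fr z 1) = ?fs g t" if "z \<in> carrier M" for z
    using hom(1)[of "?fr z 1"] that mult1 unfolding self.loc_carrier by auto
  have "\<exists>m\<in>E. \<exists>g\<in>S. \<exists>t\<in>S. \<pi> (?fr (xmon m) 1) = ?fs g t"
  proof (rule ccontr)
    assume neg: "\<not> ?thesis"
    have in_p: "\<exists>g\<in>p. \<exists>t\<in>S. \<pi> (?fr (xmon m) 1) = ?fs g t" if "m \<in> E" for m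
      using pi_frac[OF xmon_mem[OF that]] neg that unfolding S_def by blast
    have "\<exists>g\<in>p. \<exists>t\<in>S. \<pi> (?fr x 1) = ?fs g t"
      using x(1)
    proof (induction rule: semi_invariants_induct)
      case zero
      have "\<pi> (?fr 0 1) = ?fs 0 1"
        using mod_homs_zero[OF loc_module_module pi] by (simp add: loc_zero self.loc_zero)
      then show ?case using p_zero mult1 by auto
    next
      case (add x y)
      then obtain g t h u where g: "g \<in> p" "t \<in> S" "\<pi> (?fr x 1) = ?fs g t"
        and h: "h \<in> p" "u \<in> S" "\<pi> (?fr y 1) = ?fs h u" by blast
      have gh: "g \<in> carrier R" "h \<in> carrier R" using g h p.a_subset by auto
      have "?fr (x + y) 1 = ?fr x 1 \<oplus>\<^bsub>loc_module R M S\<^esub> ?fr y 1"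
        using loc_add[of x 1 y 1] add mult1 by simp
      then have "\<pi> (?fr (x + y) 1) = ?fs g t \<oplus>\<^bsub>loc_module R (self_module R) S\<^esub> ?fs h u"
        using hom(2)[of "?fr x 1" "?fr y 1"] add mult1 g h by simp
      also have "\<dots> = ?fs (u * g + t * h) (t * u)"
        using self.loc_add[of g t h u] gh g h by simp
      finally have "\<pi> (?fr (x + y) 1) = ?fs (u * g + t * h) (t * u)" .
      moreover have "u * g + t * h \<in> p"
        using p_add[OF p.I_l_closed p.I_l_closed, of g u h t] g h by simp
      moreover have "t * u \<in> S" using S_mult[OF g(2) h(2)] by simp
      ultimately show ?case by blast
    next
      case (single m c)
      then obtain g t where g: "g \<in> p" "t \<in> S" "\<pi> (?fr (xmon m) 1) = ?fs g t"
        using in_p by blast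
      have gc: "g \<in> carrier R" using g p.a_subset by auto
      have "Poly_Mapping.single m c = Const c * xmon m" by (simp add: Const_def mult_single)
      then have "\<pi> (?fr (Poly_Mapping.single m c) 1) = ?fs (Const c * g) t"
        using pi_smult[OF Const_mem xmon_mem[OF single], of c] self.loc_smult[of "Const c" 1 g t] g gc
          mult1 Const_mem by simp
      moreover have "Const c * g \<in> p" using p.I_l_closed[OF g(1) Const_mem] by simp
      ultimately show ?case using g by blast
    qed
    then obtain g t where g: "g \<in> p" "t \<in> S" "\<pi> (?fr x 1) = ?fs g t" by blast
    have gc: "g \<in> carrier R" using g p.a_subset by auto
    have sc: "s \<in> carrier R" using x by simp
    \<comment> \<open>Since \<open>b = x / s\<close>, the value of \<open>\<pi>\<close> at \<open>x / 1\<close> is the unit \<open>s / 1\<close>.\<close>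
    have "?fr x 1 = ?fs s 1 \<odot>\<^bsub>loc_module R M S\<^esub> b"
      unfolding b_eq using loc_smult[of s 1 x s] x mult1 sc smult_closed[OF sc x(1)]
      by (simp, intro fraction_eqI) auto
    then have "?fs g t = ?fs s 1 \<odot>\<^bsub>loc_module R (self_module R) S\<^esub> \<pi> b"
      using hom(3)[of "?fs s 1" b] x mult1 sc b_eq g by simp
    also have "\<dots> = ?fs s 1"
      unfolding pi_b using self.loc_smult[of s 1 1 1] sc mult1 p.one_closed by simp
    finally obtain u where u: "u \<in> S" "u * g = u * (t * s)"
      using self.fraction_eq_iff[of g t s 1] gc g sc mult1 by auto
    have "u * g \<in> p" using p.I_l_closed[OF g(1), of u] u by simp
    moreover have "u * (t * s) \<in> S"
      using S_mult[OF u(1) S_mult[OF g(2) x(2)]] by simp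
    ultimately show False using u S_p by simp
  qed
  then obtain m g t where m: "m \<in> E" and g: "g \<in> S" "t \<in> S" and pi_m: "\<pi> (?fr (xmon m) 1) = ?fs g t"
    by blast
  have "Poly_Mapping.lookup m i \<le> Poly_Mapping.lookup y i" if y: "y \<in> E" and i: "i \<noteq> j" for y i
  proof -
    obtain h t' where h: "h \<in> carrier R" "t' \<in> S" and pi_y: "\<pi> (?fr (xmon y) 1) = ?fs h t'"
      using pi_frac[OF xmon_mem[OF y]] by blast
    let ?a = "xmon m ^ (N - 1) * xmon y" and ?c = "xmon m ^ N"
    have a: "?a \<in> carrier R" by (rule cross_multiplier_mem[OF m xmon_mem[OF y]])
    have c: "?c \<in> carrier R" by (rule monomial_power_invariant)
    have "?fs (?a * g) t = \<pi> (?fr (?a * xmon m) 1)"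
      using pi_smult[OF a xmon_mem[OF m]] pi_m self.loc_smult[of ?a 1 g t] a g mult1 by simp
    also have "\<dots> = ?fs (?c * h) t'"
      unfolding cross_relation
      using pi_smult[OF c xmon_mem[OF y]] pi_y self.loc_smult[of ?c 1 h t'] c h mult1 by simp
    finally obtain u where u: "u \<in> S" "u * (t' * (?a * g)) = u * (t * (?c * h))"
      using self.fraction_eq_iff[of "?a * g" t "?c * h" t'] p.m_closed[OF a, of g] p.m_closed[OF c h(1)] g h
      by auto
    define q where "q = u * (t' * g)"
    have "xmon m ^ (N - 1) * (xmon y * q) = xmon m ^ (N - 1) * (xmon m * (u * (t * h)))"
      using u(2) N_pos by (cases N) (simp_all add: algebra_simps q_def)
    then have eq: "xmon y * q = xmon m * (u * (t * h))" by (rule single_power_mult_cancel)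
    have "q \<in> S" unfolding q_def using S_mult[OF u(1) S_mult[OF h(2) g(1)]] by simp
    then obtain k where k: "Poly_Mapping.lookup q (Poly_Mapping.single j k) \<noteq> 0"
      using axis[of q] coeff_axis_poly[of j q] by (metis poly_eqI Polynomial.coeff_0)
    have "Poly_Mapping.lookup (xmon y * q) (y + Poly_Mapping.single j k) \<noteq> 0"
      using k by (simp add: lookup_single_mult)
    then have "y + Poly_Mapping.single j k \<in> (+) m ` Poly_Mapping.keys (u * (t * h))"
      unfolding eq using keys_single_mult[of m 1 "u * (t * h)"] by (auto simp: in_keys_iff)
    then obtain r where "y + Poly_Mapping.single j k = m + r" by blast
    from arg_cong[OF this, of "\<lambda>m. Poly_Mapping.lookup m i"] show ?thesis
      using i by (simp add: lookup_add lookup_single when_def)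
  qed
  then show ?thesis using m by blast
qed

text \<open>
  The exponent found for the axis prime is bounded off \<open>j\<close> by every exponent of \<open>R\<^sup>\<phi>\<close>, and for each
  \<open>i \<noteq> j\<close> one of those has \<open>i\<close>-th entry \<open>0\<close>.
\<close>
lemma ex_pure_power:
  assumes free: "free_module (loc_ring R (carrier R - axis_prime j)) (loc_module R M (carrier R - axis_prime j))"
    and np: "\<forall>B\<in>G. \<not> pseudo_reflection B"
  shows "\<exists>u. 0 < u \<and> u \<le> N \<and> Var j ^ u \<in> carrier M"
proof -
  have "E \<noteq> {}" using ex_exponent_avoiding[OF np] by blast
  then obtain m where m: "m \<in> E"
    and le: "\<And>y i. \<lbrakk>y \<in> E; i \<noteq> j\<rbrakk> \<Longrightarrow> Poly_Mapping.lookup m i \<le> Poly_Mapping.lookup y i"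
    using ex_least_exponent_off_axis[OF free] by blast
  have "Poly_Mapping.lookup m i = 0" if "i \<noteq> j" for i
    using ex_exponent_avoiding[OF np, of i] le[OF _ that] by force
  then have "m = Poly_Mapping.single j (Poly_Mapping.lookup m j)"
    by (intro poly_mapping_eqI) (auto simp: lookup_single when_def)
  then obtain k where k: "m = Poly_Mapping.single j k" by blast
  have pow: "(A $ j $ j) ^ k = \<phi> A" if "A \<in> G" for A
    using m that by (simp add: k semi_invariant_exponents_def)
  \<comment> \<open>The residue \<open>0\<close> is represented by \<open>N\<close>, because the exponent has to be positive.\<close>
  define u where "u = (if k mod N = 0 then N else k mod N)"
  have "(A $ j $ j) ^ u = \<phi> A" if A: "A \<in> G" for A
  proof -
    have "(A $ j $ j) ^ k = ((A $ j $ j) ^ N) ^ (k div N) * (A $ j $ j) ^ (k mod N)"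
      by (simp flip: power_mult power_add)
    then have "(A $ j $ j) ^ (k mod N) = \<phi> A" using pow[OF A] entry_power[OF A] by simp
    then show ?thesis using entry_power[OF A] by (auto simp: u_def)
  qed
  moreover have "0 < u" "u \<le> N" using N_pos by (auto simp: u_def less_imp_le)
  ultimately show ?thesis by (auto simp: Var_power_mem_iff)
qed

end

section \<open>Groups generated by diagonal matrices\<close>

lemma diagonal_generate:
  fixes Y :: "('k::field^'n::finite^'n) set"
  assumes gens: "\<And>B. B \<in> Y \<Longrightarrow> \<exists>a. B = diag_matrix a \<and> (\<forall>j. a j ^ N = 1)"
    and N: "0 < N" and A: "A \<in> generate GL Y"
  shows "\<exists>a :: 'n \<Rightarrow> 'k. A = diag_matrix a \<and> (\<forall>j. a j ^ N = 1)"
  using A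
proof (induction rule: generate.induct)
  case one
  then show ?case
    by (intro exI[of _ "\<lambda>_. 1"]) (simp add: diag_matrix_one, simp add: GL_def)
next
  case (incl h)
  then show ?case by (rule gens)
next
  case (inv h)
  then obtain a where a: "h = diag_matrix a" "\<And>j. a j ^ N = 1" using gens by metis
  then have "a j \<noteq> 0" for j using N by (metis power_0_left less_numeral_extra(3) zero_neq_one)
  then have "inv\<^bsub>GL\<^esub> h = diag_matrix (\<lambda>j. inverse (a j))"
    unfolding a(1) by (rule diag_matrix_GL(2))
  then show ?case using a(2) by (auto simp: power_inverse)
next
  case (eng h1 h2)
  then obtain a b where "h1 = diag_matrix a" "\<forall>j. a j ^ N = 1" "h2 = diag_matrix b" "\<forall>j. b j ^ N = 1"
    by blast
  then show ?case
    by (intro exI[of _ "\<lambda>j. a j * b j"]) (simp add: GL_def diag_matrix_mult power_mult_distrib)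
qed

theorem theorem3p11:
  fixes \<xi> :: "nat \<Rightarrow> 'k::alg_closed_field"
    and \<sigma> :: "nat \<Rightarrow> 'k^'n::finite^'n"
    and t :: "nat \<Rightarrow> 'n \<Rightarrow> nat"
    and n :: "nat \<Rightarrow> nat"
    and l N :: nat
    and G :: "('k^'n^'n) set"
    and \<phi> :: "'k^'n^'n \<Rightarrow> 'k"
  assumes dim: "CARD('n) \<ge> 2"
    and prim: "\<And>i. i \<in> {1..l} \<Longrightarrow> primitive_root_of_unity (n i) (\<xi> i)"
    and gcd1: "\<And>i. i \<in> {1..l} \<Longrightarrow> Gcd (insert (n i) (range (t i))) = 1"
    and diag: "\<And>i. i \<in> {1..l} \<Longrightarrow> \<sigma> i = diag_matrix (\<lambda>j. \<xi> i ^ t i j)"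
    and gen: "G = generate GL (\<sigma> ` {1..l})"
    and fin: "finite G"
    and abelian: "comm_group (GL\<lparr>carrier := G\<rparr>)"
    and char: "\<not> CHAR('k) dvd card G"
    and N: "N = (\<Prod>i\<in>{1..l}. n i)"
    and character: "\<phi> \<in> characters G"
  shows
    "let A = invariant_ring G;
         M = semi_invariants G \<phi>;
         C1 = locally_free_on A M (graded_Spec A - {graded_max_ideal A});
         C2 = Idl\<^bsub>A\<^esub> (range (\<lambda>j. Var j ^ N)) \<subseteq> module_trace A M;
         C3 = (\<forall>j. \<exists>u. 0 < u \<and> u \<le> N \<and> Var j ^ u \<in> carrier M)
     in (C3 \<longrightarrow> C2) \<and> (C2 \<longrightarrow> C1) \<and>
        (pairwise (\<lambda>i j. coprime (n i) (n j)) {1..l} \<and> (\<forall>B\<in>G. \<not> pseudo_reflection B)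
           \<longrightarrow> C1 \<longrightarrow> C3)"
proof -
  have N_pos: "0 < N"
    using prim unfolding N primitive_root_of_unity_def by (intro prod_pos) auto
  have gens: "\<exists>a. B = diag_matrix a \<and> (\<forall>j. a j ^ N = 1)" if "B \<in> \<sigma> ` {1..l}" for B
  proof -
    from that obtain i where i: "i \<in> {1..l}" and B: "B = diag_matrix (\<lambda>j. \<xi> i ^ t i j)"
      using diag by auto
    have "n i dvd N" unfolding N using i by (intro dvd_prodI) auto
    moreover have "\<xi> i ^ n i = 1" using prim[OF i] by (simp add: primitive_root_of_unity_def)
    ultimately have "\<xi> i ^ N = 1" by (metis dvd_def power_mult power_one)
    then have "(\<xi> i ^ t i j) ^ N = 1" for j
      by (metis power_mult mult.commute power_one)
    then show ?thesis using B by blast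
  qed
  have diag_G: "\<exists>a. A = diag_matrix a \<and> (\<forall>j. a j ^ N = 1)" if "A \<in> G" for A
    using diagonal_generate[OF gens N_pos] that unfolding gen by blast
  have mult_G: "A ** B \<in> G" if "A \<in> G" "B \<in> G" for A B
    using generate.eng[of A GL "\<sigma> ` {1..l}" B] that unfolding gen by (simp add: GL_def)
  have hom: "\<phi> \<in> hom (GL\<lparr>carrier := G\<rparr>) (units_of ring_of_type_algebra)"
    using character by (simp add: characters_def)
  interpret diagonal_character G N \<phi>
  proof
    show "mat 1 \<in> G" using generate.one[of GL "\<sigma> ` {1..l}"] unfolding gen by (simp add: GL_def)
  next
    fix A assume A: "A \<in> G"
    then obtain a where a: "A = diag_matrix a" "\<forall>j. a j ^ N = 1" using diag_G by blast
    then show "A = diag_matrix (\<lambda>j. A $ j $ j)" by simp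
    show "(A $ j $ j) ^ N = 1" for j using a by simp
    have "\<phi> A \<in> carrier (units_of ring_of_type_algebra)"
      using hom_in_carrier[OF hom, of A] A by simp
    then show "\<phi> A \<noteq> 0"
      by (auto simp: units_of_def Units_def ring_of_type_algebra_def)
  next
    fix A B assume "A \<in> G" "B \<in> G"
    then show "\<phi> (A ** B) = \<phi> A * \<phi> B"
      using hom_mult[OF hom, of A B] by (simp add: GL_def units_of_def ring_of_type_algebra_def)
  qed (use fin mult_G N_pos in auto)
  interpret R: cring R by (rule invariant_ring_cring)
  define C1 where "C1 \<longleftrightarrow> locally_free_on R M (graded_Spec R - {graded_max_ideal R})"
  define C2 where "C2 \<longleftrightarrow> Idl\<^bsub>R\<^esub> (range (\<lambda>j. Var j ^ N)) \<subseteq> module_trace R M"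
  define C3 where "C3 \<longleftrightarrow> (\<forall>j. \<exists>u. 0 < u \<and> u \<le> N \<and> Var j ^ u \<in> carrier M)"
  have "C3 \<longrightarrow> C2"
    unfolding C2_def C3_def by (intro impI trace_contains_powers) (rule spec)
  moreover have "C2 \<longrightarrow> C1"
    unfolding C1_def locally_free_on_def
  proof (intro impI ballI)
    fix p assume C2 and p: "p \<in> graded_Spec R - {graded_max_ideal R}"
    then obtain j where "Var j ^ N \<notin> p" using graded_prime_misses_Var_power[of p] by blast
    moreover have "Var j ^ N \<in> module_trace R M"
      using \<open>C2\<close> R.genideal_self[of "range (\<lambda>j. Var j ^ N)"] Var_power_N_mem
      unfolding C2_def by blast
    ultimately show "free_module (loc_ring R (carrier R - p)) (loc_module R M (carrier R - p))"
      using p by (intro free_at_prime_if_trace) (auto simp: graded_Spec_def)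
  qed
  moreover have "C3" if np: "\<forall>B\<in>G. \<not> pseudo_reflection B" and C1
    unfolding C3_def
  proof
    fix j
    have "axis_prime j \<in> graded_Spec R - {graded_max_ideal R}"
      using axis_prime_graded axis_prime_not_max by blast
    then show "\<exists>u. 0 < u \<and> u \<le> N \<and> Var j ^ u \<in> carrier M"
      using \<open>C1\<close> np unfolding C1_def locally_free_on_def by (intro ex_pure_power) auto
  qed
  ultimately show ?thesis
    unfolding Let_def C1_def C2_def C3_def by blast
qed

end
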